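(* Let $\Gamma$ be a bipartite $Q$-polynomial distance-regular graph with diameter $D$ and valency $k\ge 3$. If $D\ge 6$, then $c_2\ge 2$. In particular, the girth of $\Gamma$ equals $4$.
   Context: Graphs are finite, undirected, connected, simple. For a distance-regular graph, $c_i=p^i_{1,i-1}$ where $p^h_{ij}=|\Gamma_i(x)\cap\Gamma_j(y)|$ for $\partial(x,y)=h$ (independent of $x,y$). $Q$-polynomial: there is an ordering $E_0,\dots,E_D$ of the primitive idempotents of the Bose–Mesner algebra, with $E_0=|X|^{-1}J$, such that the Krein parameters defined by $E_i\circ E_j=|X|^{-1}\sum_h q^h_{ij}E_h$ satisfy, for distinct $i,j$, $q^1_{ij}\ne0$ iff $|i-j|=1$. *)

theory Defs
  imports "HOL-Analysis.Analysis" "HOL-Library.Extended_Nat"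
begin

text \<open>
  A graph is given by its adjacency relation on a finite type of vertices, so that
  matrices indexed by the vertex set are elements of \<^typ>\<open>real ^ 'v ^ 'v\<close>.
\<close>

type_synonym 'v graph = "'v \<Rightarrow> 'v \<Rightarrow> bool"

definition simple_graph :: "'v graph \<Rightarrow> bool" where
  "simple_graph G \<longleftrightarrow> symp G \<and> irreflp G"

definition connected_graph :: "'v graph \<Rightarrow> bool" where
  "connected_graph G \<longleftrightarrow> (\<forall>x y. G\<^sup>*\<^sup>* x y)"

definition bipartite_graph :: "'v graph \<Rightarrow> bool" where
  "bipartite_graph G \<longleftrightarrow> (\<exists>U. \<forall>x y. G x y \<longrightarrow> (x \<in> U \<longleftrightarrow> y \<notin> U))"

text \<open>\<open>(G ^^ n) x y\<close> says that there is a walk of length \<open>n\<close> from \<open>x\<close> to \<open>y\<close>;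
  the value is only meaningful for vertices in the same component.\<close>

definition gdist :: "'v graph \<Rightarrow> 'v \<Rightarrow> 'v \<Rightarrow> nat" where
  "gdist G x y = (LEAST n. (G ^^ n) x y)"

definition diam :: "('v::finite) graph \<Rightarrow> nat" where
  "diam G = Max {gdist G x y | x y. True}"

definition gsphere :: "'v graph \<Rightarrow> nat \<Rightarrow> 'v \<Rightarrow> 'v set" where
  "gsphere G i x = {z. gdist G x z = i}"

definition regular_graph :: "('v::finite) graph \<Rightarrow> nat \<Rightarrow> bool" where
  "regular_graph G k \<longleftrightarrow> (\<forall>x. card {y. G x y} = k)"

definition is_cycle :: "'v graph \<Rightarrow> 'v list \<Rightarrow> bool" where
  "is_cycle G vs \<longleftrightarrow> 3 \<le> length vs \<and> distinct vs \<and>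
     (\<forall>i < length vs. G (vs ! i) (vs ! (Suc i mod length vs)))"

definition girth :: "'v graph \<Rightarrow> enat" where
  "girth G = (INF vs \<in> {vs. is_cycle G vs}. enat (length vs))"

definition distance_regular :: "('v::finite) graph \<Rightarrow> bool" where
  "distance_regular G \<longleftrightarrow> simple_graph G \<and> connected_graph G \<and>
     (\<exists>p. \<forall>x y i j. card (gsphere G i x \<inter> gsphere G j y) = p (gdist G x y) i j)"

text \<open>The intersection number \<open>p\<^sup>h\<^sub>i\<^sub>j\<close>, well defined for a
  distance-regular graph when \<open>h \<le> diam G\<close>.\<close>

definition intersection_number :: "('v::finite) graph \<Rightarrow> nat \<Rightarrow> nat \<Rightarrow> nat \<Rightarrow> nat" where
  "intersection_number G h i j =
     (THE n. \<forall>x y. gdist G x y = h \<longrightarrow> card (gsphere G i x \<inter> gsphere G j y) = n)"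

definition c_number :: "('v::finite) graph \<Rightarrow> nat \<Rightarrow> nat" where
  "c_number G i = intersection_number G i 1 (i - 1)"

definition distance_matrix :: "('v::finite) graph \<Rightarrow> nat \<Rightarrow> real ^ 'v ^ 'v" where
  "distance_matrix G i = (\<chi> x y. if gdist G x y = i then 1 else 0)"

definition bose_mesner :: "('v::finite) graph \<Rightarrow> (real ^ 'v ^ 'v) set" where
  "bose_mesner G = span (distance_matrix G ` {0..diam G})"

definition idempotent_in :: "(real ^ 'v ^ 'v) set \<Rightarrow> real ^ 'v ^ ('v::finite) \<Rightarrow> bool" where
  "idempotent_in M e \<longleftrightarrow> e \<in> M \<and> e ** e = e"

definition primitive_idempotent_in :: "(real ^ 'v ^ 'v) set \<Rightarrow> real ^ 'v ^ ('v::finite) \<Rightarrow> bool" where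
  "primitive_idempotent_in M e \<longleftrightarrow> idempotent_in M e \<and> e \<noteq> 0 \<and>
     \<not> (\<exists>f g. idempotent_in M f \<and> idempotent_in M g \<and> f \<noteq> 0 \<and> g \<noteq> 0 \<and>
            f ** g = 0 \<and> g ** f = 0 \<and> e = f + g)"

text \<open>The type class product \<open>*\<close> on \<^typ>\<open>real ^ 'v ^ 'v\<close> is the entrywise (Hadamard)
  product, whereas \<open>**\<close> is the matrix product. Here \<open>q h i j\<close> stands for
  \<open>q\<^sup>h\<^sub>i\<^sub>j\<close>; since the primitive idempotents are linearly independent, the
  values of \<open>q\<close> on indices up to \<open>D\<close> are uniquely determined.\<close>

definition krein_parameters ::
  "nat \<Rightarrow> (nat \<Rightarrow> real ^ 'v ^ ('v::finite)) \<Rightarrow> (nat \<Rightarrow> nat \<Rightarrow> nat \<Rightarrow> real) \<Rightarrow> bool" where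
  "krein_parameters D E q \<longleftrightarrow>
     (\<forall>i\<le>D. \<forall>j\<le>D. E i * E j = (1 / real CARD('v)) *\<^sub>R (\<Sum>h\<le>D. q h i j *\<^sub>R E h))"

definition Q_polynomial :: "('v::finite) graph \<Rightarrow> bool" where
  "Q_polynomial G \<longleftrightarrow>
     (\<exists>(E :: nat \<Rightarrow> real ^ 'v ^ 'v) q.
        bij_betw E {0..diam G} {e. primitive_idempotent_in (bose_mesner G) e} \<and>
        E 0 = (1 / real CARD('v)) *\<^sub>R (\<chi> x y. 1) \<and>
        krein_parameters (diam G) E q \<and>
        (\<forall>i\<le>diam G. \<forall>j\<le>diam G. i \<noteq> j \<longrightarrow>
           (q 1 i j \<noteq> 0 \<longleftrightarrow> \<bar>int i - int j\<bar> = 1)))"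

end

theory Submission
  imports Defs
begin

text \<open>
  Suppose \<open>c\<^sub>2 = 1\<close>, and let \<open>u\<close> be the sequence of entries of \<open>E\<^sub>1\<close>, with eigenvalue \<open>\<theta>\<close>.
  Vanishing of \<open>q\<^sup>1\<^sub>i\<^sub>j\<close> for \<open>\<bar>i - j\<bar> > 1\<close> yields Terwilliger's balanced set condition, which has two
  consequences. First, \<open>u\<close> satisfies a linear recurrence, so that \<open>k\<close> and \<open>\<theta>\<close> determine everything;
  integrality of \<open>c\<^sub>3\<close> and \<open>2 c\<^sub>3 \<le> k\<close> (here \<open>D \<ge> 6\<close> enters) then force \<open>1 - k \<le> \<theta> < -1\<close>.
  Secondly, the neighbourhoods of two vertices at distance \<open>D\<close> carry a symmetric design, whence
  \<open>k - 1\<close> divides \<open>b (b - 1)\<close> for \<open>b = b\<^sub>D\<^sub>-\<^sub>1\<close>. For \<open>1 - k \<le> \<theta> < -1\<close> the solution of the recurrence shows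
  that \<open>D\<close> is odd, hence \<open>D \<ge> 7\<close>, and that \<open>1 < b\<close> and \<open>b\<^sup>2 \<le> k\<close>, a contradiction.
\<close>

section \<open>Distances and intersection numbers\<close>

text \<open>The assumption \<open>c 2 = 1\<close> enters in two ways. As a number it gives
  \<open>b 1 = b 2 = k - 1\<close>, so that the normalised values of \<open>u\<close> at 1, 2, 3 are
  rational functions of k and \<theta>, from which the recurrence continues. Combinatorially it says
  that two neighbours of w have only w as a common neighbour; this fixes one side of the balanced
  set condition and makes the block intersections constant. Integrality of \<open>c 3\<close> serves
  to turn \<open>c 3 > 1\<close> into \<open>c 3 \<ge> 2\<close>. The final clash: if b > 1, the
  complementary design yields k - 1 \<le> b (b - 1), which together with b^2 \<le> k forces b \<le>
  1. The bound b^2 \<le> k rests on comparing p^D with a polynomial of degree 7 in p, where p > 1 is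
  a root attached to the recurrence; this is why excluding D = 6 by parity matters. At the boundary
  \<theta> = 1 - k the root degenerates to p = 1, and this case is refuted separately.\<close>

locale bipartite_drg =
  fixes G :: "('v::finite) graph" and p :: "nat \<Rightarrow> nat \<Rightarrow> nat \<Rightarrow> nat" and D k :: nat
  assumes simple: "simple_graph G"
    and connected: "connected_graph G"
    and bipartite: "bipartite_graph G"
    and sphere_inter: "card (gsphere G i x \<inter> gsphere G j y) = p (gdist G x y) i j"
    and diam: "diam G = D"
    and regular: "regular_graph G k"
begin

abbreviation d where "d \<equiv> gdist G"

lemma adj_sym: "G x y \<Longrightarrow> G y x"
  using simple unfolding simple_graph_def by (blast dest: sympD)

lemma adj_irrefl: "\<not> G x x"
  using simple unfolding simple_graph_def by (blast dest: irreflpD)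

lemma walk_dist: "(G ^^ d x y) x y"
proof -
  have "G\<^sup>*\<^sup>* x y" using connected by (simp add: connected_graph_def)
  then obtain n where "(G ^^ n) x y" by (auto dest: rtranclp_imp_relpowp)
  then show ?thesis unfolding gdist_def by (rule LeastI)
qed

lemma dist_le: "(G ^^ n) x y \<Longrightarrow> d x y \<le> n"
  unfolding gdist_def by (rule Least_le)

lemma dist_eq_0_iff [simp]: "d x y = 0 \<longleftrightarrow> x = y"
  using walk_dist[of x y] dist_le[of 0 x y] by auto

lemma dist_refl [simp]: "d x x = 0"
  by simp

lemma dist_eq_1_iff: "d x y = 1 \<longleftrightarrow> G x y"
proof
  assume "d x y = 1"
  then show "G x y" using walk_dist[of x y] by (simp add: relcompp_apply)
next
  assume "G x y"
  then have "d x y \<le> 1" "x \<noteq> y" using dist_le[of 1 x y] adj_irrefl by auto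
  then show "d x y = 1" using dist_eq_0_iff[of x y] by linarith
qed

lemma dist_eq_Suc_0_iff: "d x y = Suc 0 \<longleftrightarrow> G x y"
  using dist_eq_1_iff by simp

lemma walk_rev: "(G ^^ n) x y \<Longrightarrow> (G ^^ n) y x"
proof (induction n arbitrary: y)
  case (Suc n)
  then obtain z where "(G ^^ n) x z" "G z y" by (auto elim: relpowp_Suc_E)
  then show ?case using Suc.IH adj_sym by (blast intro: relpowp_Suc_I2)
qed simp

lemma dist_commute: "d x y = d y x"
  using walk_rev[OF walk_dist] dist_le by (meson order_antisym)

lemma dist_triangle: "d x z \<le> d x y + d y z"
proof (rule dist_le)
  show "(G ^^ (d x y + d y z)) x z"
    using walk_dist[of x y] walk_dist[of y z] by (auto simp: relpowp_add)
qed

lemma dist_split: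
  assumes "d x y = i + j"
  obtains z where "d x z = i" "d z y = j"
proof -
  have "(G ^^ (i + j)) x y" using walk_dist[of x y] assms by simp
  then obtain z where z: "(G ^^ i) x z" "(G ^^ j) z y"
    by (auto simp: relpowp_add)
  have "d x z \<le> i" "d z y \<le> j" using z dist_le by auto
  then show ?thesis using that[of z] dist_triangle[of x y z] assms by linarith
qed

text \<open>Each step of a walk changes the colour class, so the parity of a walk is determined by
  its end points. Hence equal distances to both ends of an edge are impossible, and the triangle
  inequality leaves a change by exactly one.\<close>

lemma dist_parity:
  assumes "G y z"
  shows "d x z = d x y + 1 \<or> d x y = d x z + 1"
proof -
  obtain U where U: "\<And>x y. G x y \<Longrightarrow> (x \<in> U \<longleftrightarrow> y \<notin> U)"
    using bipartite unfolding bipartite_graph_def by blast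
  have walk: "(G ^^ n) a b \<Longrightarrow> (a \<in> U \<longleftrightarrow> b \<in> U) \<longleftrightarrow> even n" for n a b
  proof (induction n arbitrary: b)
    case (Suc n)
    then obtain c where "(G ^^ n) a c" "G c b" by (auto elim: relpowp_Suc_E)
    then show ?case using Suc.IH[of c] U[of c b] by auto
  qed simp
  have "even (d x y) \<noteq> even (d x z)"
    using walk[OF walk_dist[of x y]] walk[OF walk_dist[of x z]] U[OF assms] by auto
  moreover have "d y z = 1" "d z y = 1"
    using assms adj_sym dist_eq_1_iff by blast+
  then have "d x z \<le> d x y + 1" "d x y \<le> d x z + 1"
    using dist_triangle[of x z y] dist_triangle[of x y z] by auto
  moreover have "d x y \<noteq> d x z" using calculation(1) by auto
  ultimately show ?thesis by linarith
qed

lemma dist_le_diam: "d x y \<le> D"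
proof -
  have "{d x y | x y. True} = (\<lambda>(x, y). d x y) ` UNIV" by auto
  then have "finite {d x y | x y. True}" by simp
  then show ?thesis unfolding diam[symmetric] diam_def by (auto intro: Max_ge)
qed

lemma diam_attained: obtains x y where "d x y = D"
proof -
  have "{d x y | x y. True} = (\<lambda>(x, y). d x y) ` UNIV" by auto
  then have "finite {d x y | x y. True}" "{d x y | x y. True} \<noteq> {}" by auto
  then have "D \<in> {d x y | x y. True}" unfolding diam[symmetric] diam_def by (rule Max_in)
  then show ?thesis using that by auto
qed

lemma pair_at_distance:
  assumes "i \<le> D"
  shows "\<exists>x y. d x y = i"
proof -
  obtain x y where "d x y = D" using diam_attained by blast
  then have "d x y = i + (D - i)" using assms by simp
  then show ?thesis by (rule dist_split) blast
qed

section \<open>The intersection numbers \<open>c i\<close> and \<open>b i\<close>\<close>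

definition c :: "nat \<Rightarrow> nat" where "c i = p i 1 (i - 1)"
definition b :: "nat \<Rightarrow> nat" where "b i = p i 1 (i + 1)"

lemma card_closer: "card {z. G x z \<and> d z y + 1 = i} = c i" if "d x y = i" "0 < i"
proof -
  have "{z. G x z \<and> d z y + 1 = i} = gsphere G 1 x \<inter> gsphere G (i - 1) y"
    using that by (auto simp: gsphere_def dist_eq_Suc_0_iff dist_commute[of y])
  then show ?thesis using sphere_inter that by (simp add: c_def)
qed

lemma card_farther: "card {z. G x z \<and> d z y = i + 1} = b i" if "d x y = i"
proof -
  have "{z. G x z \<and> d z y = i + 1} = gsphere G 1 x \<inter> gsphere G (i + 1) y"
    using that by (auto simp: gsphere_def dist_eq_Suc_0_iff dist_commute[of y])
  then show ?thesis using sphere_inter that by (simp add: b_def)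
qed

lemma degree: "card {z. G x z} = k"
  using regular by (simp add: regular_graph_def)

lemma neighbours_split:
  "d x y = i \<Longrightarrow> {z. G x z} = {z. G x z \<and> d z y + 1 = i} \<union> {z. G x z \<and> d z y = i + 1}"
  using dist_parity[of x _ y] by (fastforce simp: dist_commute[of _ y])

lemma c_plus_b: "c i + b i = k" if pos: "0 < i" and ij: "i \<le> D"
proof -
  obtain x y where xy: "d x y = i" using pair_at_distance[OF ij] by blast
  have "k = card ({z. G x z \<and> d z y + 1 = i} \<union> {z. G x z \<and> d z y = i + 1})"
    using neighbours_split[OF xy] degree[of x] by simp
  also have "\<dots> = card {z. G x z \<and> d z y + 1 = i} + card {z. G x z \<and> d z y = i + 1}"
    by (rule card_Un_disjoint) auto
  finally show ?thesis using card_closer[OF xy] card_farther[OF xy] pos by simp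
qed

lemma c_pos: "1 \<le> c i" if pos: "0 < i" and ij: "i \<le> D"
proof -
  obtain x y where xy: "d x y = i" using pair_at_distance[OF ij] by blast
  then obtain z where "d x z = 1" "d z y = i - 1"
    using dist_split[of x y 1 "i - 1"] pos by auto
  then have "z \<in> {z. G x z \<and> d z y + 1 = i}" using pos dist_eq_1_iff by auto
  then have "0 < card {z. G x z \<and> d z y + 1 = i}" by (auto simp: card_gt_0_iff)
  then show ?thesis using card_closer[OF xy pos] by linarith
qed

lemma b_pos: "1 \<le> b i" if ij: "i < D"
proof -
  obtain x y where xy: "d x y = i + 1" using pair_at_distance[of "i + 1"] ij by auto
  then obtain z where z: "d x z = 1" "d z y = i"
    using dist_split[of x y 1 i] by (auto simp: add.commute)
  then have "x \<in> {w. G z w \<and> d w y = i + 1}" using xy dist_eq_1_iff adj_sym by auto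
  then have "0 < card {w. G z w \<and> d w y = i + 1}" by (auto simp: card_gt_0_iff)
  then show ?thesis using card_farther[OF z(2)] by linarith
qed

lemma b_diam: "b D = 0"
proof -
  obtain x y where xy: "d x y = D" using diam_attained by blast
  have "d w y \<noteq> D + 1" for w using dist_le_diam[of w y] by linarith
  then have empty: "{w. G x w \<and> d w y = D + 1} = {}" by blast
  show ?thesis using card_farther[OF xy] unfolding empty by simp
qed

lemma c_1: "c 1 = 1" if ij: "1 \<le> D"
proof -
  obtain x y where xy: "d x y = 1" using pair_at_distance[OF ij] by blast
  then have "{z. G x z \<and> d z y + 1 = 1} = {y}" using dist_eq_1_iff by auto
  then show ?thesis using card_closer[OF xy] by simp
qed

text \<open>Take y on a geodesic from x to z. A neighbour of y that is closer to x must be farther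
  from z, since otherwise it would shorten the geodesic. With i = j = 3 this becomes 2 c_3 \<le> k
  and requires D \<ge> 6.\<close>

lemma c_le_b: "c i \<le> b j" if pos: "0 < i" and ij: "i + j \<le> D"
proof -
  obtain x z where xz: "d x z = i + j" using pair_at_distance[OF ij] by blast
  then obtain y where y: "d x y = i" "d y z = j" using dist_split[of x z i j] by blast
  have "{w. G y w \<and> d w x + 1 = i} \<subseteq> {w. G y w \<and> d w z = j + 1}"
  proof (rule subsetI)
    fix w assume "w \<in> {w. G y w \<and> d w x + 1 = i}"
    then have "G y w" "d w x + 1 = i" by auto
    then have "d w z = j + 1"
      using dist_parity[of y w z] dist_triangle[of x z w] xz y
        dist_commute[of w x] dist_commute[of z w] dist_commute[of z y] by linarith
    then show "w \<in> {w. G y w \<and> d w z = j + 1}" using \<open>G y w\<close> by simp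
  qed
  then have "card {w. G y w \<and> d w x + 1 = i} \<le> card {w. G y w \<and> d w z = j + 1}"
    by (intro card_mono) auto
  then show ?thesis using card_closer[of y x i] card_farther[OF y(2)] y pos
    by (simp add: dist_commute)
qed

lemma unique_common_neighbour:
  assumes "c 2 = 1" "d x y = 2" "G x w" "G w y" "G x v" "G v y"
  shows "v = w"
proof -
  have "card {z. G x z \<and> d z y + 1 = 2} = 1" using card_closer[OF assms(2)] assms by simp
  then obtain a where a: "{z. G x z \<and> d z y + 1 = 2} = {a}" by (rule card_1_singletonE)
  have "v \<in> {z. G x z \<and> d z y + 1 = 2}" "w \<in> {z. G x z \<and> d z y + 1 = 2}"
    using assms by (auto simp: dist_eq_Suc_0_iff)
  then show ?thesis unfolding a by simp
qed

end

section \<open>The Bose-Mesner algebra\<close>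

lemma linear_matrix_mult_left: "linear (\<lambda>X :: real ^ 'n ^ 'm. X ** B)"
  by (rule linearI)
     (auto simp: matrix_matrix_mult_def vec_eq_iff sum.distrib distrib_right sum_distrib_left mult.assoc)

lemma linear_matrix_mult_right: "linear (\<lambda>X :: real ^ 'n ^ 'm. B ** X)"
  by (rule linearI)
     (auto simp: matrix_matrix_mult_def vec_eq_iff sum.distrib distrib_left sum_distrib_left mult_ac)

lemma matrix_mult_sum_left: "(\<Sum>i\<in>I. r i *\<^sub>R X i) ** (B :: real ^ 'n ^ 'm) = (\<Sum>i\<in>I. r i *\<^sub>R (X i ** B))"
  by (simp add: linear_sum[OF linear_matrix_mult_left] linear_cmul[OF linear_matrix_mult_left])

lemma matrix_mult_sum_right: "(B :: real ^ 'n ^ 'm) ** (\<Sum>i\<in>I. r i *\<^sub>R X i) = (\<Sum>i\<in>I. r i *\<^sub>R (B ** X i))"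
  by (simp add: linear_sum[OF linear_matrix_mult_right] linear_cmul[OF linear_matrix_mult_right])

lemma matrix_mult_nth: "(A ** B) $ x $ y = (\<Sum>z\<in>UNIV. A $ x $ z * B $ z $ y)"
  by (simp add: matrix_matrix_mult_def)

context bipartite_drg
begin

abbreviation M where "M \<equiv> bose_mesner G"

lemma subspace_M: "subspace M"
  unfolding bose_mesner_def by (rule subspace_span)

text \<open>This form lets membership in the algebra, symmetry and products be checked entrywise.
  Values of f beyond D do not affect the matrix.\<close>

lemma M_iff: "R \<in> M \<longleftrightarrow> (\<exists>f. R = (\<chi> x y. f (d x y)))"
proof
  assume "R \<in> M"
  then have "R \<in> span (distance_matrix G ` {0..D})" by (simp add: bose_mesner_def diam)
  then show "\<exists>f. R = (\<chi> x y. f (d x y))"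
  proof (induction rule: span_induct_alt)
    case base
    then show ?case by (intro exI[of _ "\<lambda>_. 0"]) (simp add: vec_eq_iff)
  next
    case (step a S T)
    then obtain f i where "T = (\<chi> x y. f (d x y))" "S = distance_matrix G i" by auto
    then show ?case
      by (intro exI[of _ "\<lambda>j. a * (if j = i then 1 else 0) + f j"])
         (simp add: vec_eq_iff distance_matrix_def)
  qed
next
  assume "\<exists>f. R = (\<chi> x y. f (d x y))"
  then obtain f where f: "R = (\<chi> x y. f (d x y))" by blast
  have "(\<Sum>i\<in>{0..D}. f i * (if d x y = i then 1 else 0)) = f (d x y)" for x y
  proof -
    have "(\<Sum>i\<in>{0..D}. f i * (if d x y = i then 1 else 0)) = (\<Sum>i\<in>{0..D}. if i = d x y then f i else 0)"
      by (rule sum.cong) auto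
    then show ?thesis using dist_le_diam[of x y] by simp
  qed
  then have "R = (\<Sum>i\<in>{0..D}. f i *\<^sub>R distance_matrix G i)"
    by (simp add: f vec_eq_iff distance_matrix_def)
  moreover have "distance_matrix G i \<in> M" if "i \<in> {0..D}" for i
    unfolding bose_mesner_def diam using that by (intro span_base) blast
  ultimately show "R \<in> M"
    using subspace_M by (auto intro!: subspace_sum subspace_scale)
qed

lemma M_sym: "R \<in> M \<Longrightarrow> R $ x $ y = R $ y $ x"
  using M_iff dist_commute[of x y] by auto

text \<open>Sorting the summation vertex z by its distances to x and y leaves only cardinalities of
  sphere intersections, which depend on \<open>d x y\<close> alone.\<close>

lemma M_mult: assumes "R \<in> M" "S \<in> M" shows "R ** S \<in> M"
proof -
  obtain f g where fg: "R = (\<chi> x y. f (d x y))" "S = (\<chi> x y. g (d x y))"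
    using assms M_iff by meson
  have "(R ** S) $ x $ y = (\<Sum>i\<le>D. \<Sum>j\<le>D. f i * g j * p (d x y) i j)" for x y
  proof -
    have "(R ** S) $ x $ y = (\<Sum>z\<in>UNIV. f (d x z) * g (d y z))"
      by (simp add: matrix_mult_nth fg dist_commute[of y])
    also have "\<dots> = (\<Sum>z\<in>UNIV. \<Sum>i\<le>D. \<Sum>j\<le>D. if i = d x z \<and> j = d y z then f i * g j else 0)"
    proof (rule sum.cong)
      fix z
      have "(\<Sum>i\<le>D. \<Sum>j\<le>D. if i = d x z \<and> j = d y z then f i * g j else 0)
          = (\<Sum>i\<le>D. if i = d x z then (\<Sum>j\<le>D. if j = d y z then f i * g j else 0) else 0)"
        by (intro sum.cong) auto
      also have "\<dots> = f (d x z) * g (d y z)" using dist_le_diam by simp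
      finally show "f (d x z) * g (d y z) = (\<Sum>i\<le>D. \<Sum>j\<le>D. if i = d x z \<and> j = d y z then f i * g j else 0)"
        by simp
    qed simp
    also have "\<dots> = (\<Sum>i\<le>D. \<Sum>z\<in>UNIV. \<Sum>j\<le>D. if i = d x z \<and> j = d y z then f i * g j else 0)"
      by (rule sum.swap)
    also have "\<dots> = (\<Sum>i\<le>D. \<Sum>j\<le>D. \<Sum>z\<in>UNIV. if i = d x z \<and> j = d y z then f i * g j else 0)"
      by (intro sum.cong sum.swap refl)
    also have "\<dots> = (\<Sum>i\<le>D. \<Sum>j\<le>D. f i * g j * p (d x y) i j)"
    proof (intro sum.cong refl)
      fix i j
      have "(\<Sum>z\<in>UNIV. if i = d x z \<and> j = d y z then f i * g j else 0)
          = (\<Sum>z\<in>gsphere G i x \<inter> gsphere G j y. f i * g j)"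
        by (rule sum.mono_neutral_cong_right) (auto simp: gsphere_def)
      then show "(\<Sum>z\<in>UNIV. if i = d x z \<and> j = d y z then f i * g j else 0) = f i * g j * p (d x y) i j"
        using sphere_inter by simp
    qed
    finally show ?thesis .
  qed
  then show ?thesis unfolding M_iff
    by (intro exI[of _ "\<lambda>h. \<Sum>i\<le>D. \<Sum>j\<le>D. f i * g j * p h i j"]) (simp add: vec_eq_iff)
qed

lemma M_commute: assumes "R \<in> M" "S \<in> M" shows "R ** S = S ** R"
proof -
  have "(R ** S) $ x $ y = (S ** R) $ x $ y" for x y
  proof -
    have "(R ** S) $ x $ y = (R ** S) $ y $ x" using M_mult assms M_sym by blast
    also have "\<dots> = (\<Sum>z\<in>UNIV. R $ y $ z * S $ z $ x)" by (simp add: matrix_mult_nth)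
    also have "\<dots> = (\<Sum>z\<in>UNIV. S $ x $ z * R $ z $ y)"
      by (intro sum.cong refl) (metis M_sym assms mult.commute)
    finally show ?thesis by (simp add: matrix_mult_nth)
  qed
  then show ?thesis by (simp add: vec_eq_iff)
qed

section \<open>Idempotents of the commutative algebra \<open>M\<close>\<close>

lemma idempotent_mult:
  assumes "idempotent_in M e" "idempotent_in M f"
  shows "idempotent_in M (e ** f)"
proof -
  have "e ** f ** (e ** f) = (e ** e) ** (f ** f)"
    using assms M_commute[of f e] by (metis idempotent_in_def matrix_mul_assoc)
  then show ?thesis using assms M_mult by (simp add: idempotent_in_def)
qed

text \<open>Otherwise e = e f + (e - e f) would split e into two nonzero orthogonal idempotents of
  \<open>M\<close>.\<close>

lemma primitive_mult_cases:
  assumes "primitive_idempotent_in M e" "idempotent_in M f"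
  shows "e ** f = 0 \<or> e ** f = e"
proof (rule ccontr)
  assume neg: "\<not> ?thesis"
  let ?g = "e ** f" and ?h = "e - e ** f"
  have e: "e \<in> M" "e ** e = e" and f: "f \<in> M" "f ** f = f"
    using assms by (auto simp: primitive_idempotent_in_def idempotent_in_def)
  have g: "idempotent_in M ?g" using assms idempotent_mult by (simp add: primitive_idempotent_in_def)
  have eg: "e ** ?g = ?g" using e by (simp add: matrix_mul_assoc)
  have ge: "?g ** e = ?g" using eg M_commute[of e ?g] g e by (simp add: idempotent_in_def)
  have gg: "?g ** ?g = ?g" using g by (simp add: idempotent_in_def)
  have "?h ** ?h = ?h"
    using e gg eg ge by (simp add: linear_diff[OF linear_matrix_mult_left] linear_diff[OF linear_matrix_mult_right])
  then have h: "idempotent_in M ?h"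
    using e g subspace_M by (simp add: idempotent_in_def subspace_diff)
  have "?g ** ?h = 0" "?h ** ?g = 0"
    using gg eg ge by (simp_all add: linear_diff[OF linear_matrix_mult_left] linear_diff[OF linear_matrix_mult_right])
  then show False
    using assms(1) g h neg unfolding primitive_idempotent_in_def
    by (metis add.commute diff_add_cancel right_minus_eq)
qed

lemma primitive_orthogonal:
  assumes "primitive_idempotent_in M e" "primitive_idempotent_in M f" "e \<noteq> f"
  shows "e ** f = 0"
  using primitive_mult_cases[of e f] primitive_mult_cases[of f e] assms M_commute[of e f]
  by (auto simp: primitive_idempotent_in_def idempotent_in_def)

end

section \<open>Primitive idempotents\<close>

locale bipartite_qdrg = bipartite_drg G p D k
  for G :: "('v::finite) graph" and p :: "nat \<Rightarrow> nat \<Rightarrow> nat \<Rightarrow> nat" and D k :: nat +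
  fixes E :: "nat \<Rightarrow> real ^ 'v ^ 'v" and q :: "nat \<Rightarrow> nat \<Rightarrow> nat \<Rightarrow> real"
  assumes E_bij: "bij_betw E {0..D} {e. primitive_idempotent_in (bose_mesner G) e}"
    and E_0: "E 0 = (1 / real CARD('v)) *\<^sub>R (\<chi> x y. 1)"
    and krein: "krein_parameters D E q"
    and tridiagonal: "\<And>i j. i \<le> D \<Longrightarrow> j \<le> D \<Longrightarrow> i \<noteq> j \<Longrightarrow> q 1 i j \<noteq> 0 \<longleftrightarrow> \<bar>int i - int j\<bar> = 1"
    and diam_pos: "1 \<le> D"
begin

lemma E_primitive: "i \<le> D \<Longrightarrow> primitive_idempotent_in M (E i)"
  using bij_betw_apply[OF E_bij, of i] by auto

lemma E_in_M: "i \<le> D \<Longrightarrow> E i \<in> M"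
  using E_primitive by (auto simp: primitive_idempotent_in_def idempotent_in_def)

lemma E_nonzero: "i \<le> D \<Longrightarrow> E i \<noteq> 0"
  using E_primitive by (auto simp: primitive_idempotent_in_def)

lemma E_sym: "i \<le> D \<Longrightarrow> E i $ x $ y = E i $ y $ x"
  using E_in_M M_sym by blast

lemma E_mult: "i \<le> D \<Longrightarrow> j \<le> D \<Longrightarrow> E i ** E j = (if i = j then E i else 0)"
proof -
  assume ij: "i \<le> D" "j \<le> D"
  show ?thesis
  proof (cases "i = j")
    case True
    then show ?thesis using E_primitive[OF ij(1)]
      by (auto simp: primitive_idempotent_in_def idempotent_in_def)
  next
    case False
    then have "E i \<noteq> E j" using E_bij ij by (auto simp: bij_betw_def inj_on_def)
    then show ?thesis using False primitive_orthogonal E_primitive ij by simp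
  qed
qed

lemma E_expand_mult:
  assumes "j \<le> D"
  shows "(\<Sum>i\<le>D. r i *\<^sub>R E i) ** E j = r j *\<^sub>R E j"
proof -
  have "(\<Sum>i\<le>D. r i *\<^sub>R E i) ** E j = (\<Sum>i\<le>D. r i *\<^sub>R (if i = j then E i else 0))"
    unfolding matrix_mult_sum_left by (rule sum.cong) (auto simp: E_mult assms)
  also have "\<dots> = (\<Sum>i\<le>D. if i = j then r i *\<^sub>R E i else 0)" by (rule sum.cong) auto
  finally show ?thesis using assms by simp
qed

lemma inj_E: "inj_on E {..D}"
  using E_bij by (simp add: bij_betw_def atLeast0AtMost)

lemma independent_E: "independent (E ` {..D})"
proof (rule independent_if_scalars_zero)
  fix f e assume sum: "(\<Sum>x\<in>E ` {..D}. f x *\<^sub>R x) = 0" and e: "e \<in> E ` {..D}"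
  then obtain j where j: "j \<le> D" "e = E j" by blast
  have "(\<Sum>i\<le>D. f (E i) *\<^sub>R E i) = 0"
    using sum by (simp add: sum.reindex[OF inj_E] o_def)
  then have "f (E j) *\<^sub>R E j = 0"
    using E_expand_mult[OF j(1), of "\<lambda>i. f (E i)"] by simp
  then show "f e = 0" using E_nonzero j by simp
qed simp

text \<open>The \<open>D + 1\<close> orthogonal idempotents are linearly independent in a space spanned by
  \<open>D + 1\<close> distance matrices; this replaces an appeal to the spectral theorem.\<close>

lemma M_expand:
  assumes "R \<in> M"
  obtains r where "R = (\<Sum>i\<le>D. r i *\<^sub>R E i)"
proof -
  have "dim M \<le> card (distance_matrix G ` {0..D})"
    unfolding bose_mesner_def diam by (intro dim_le_card) auto
  also have "\<dots> \<le> D + 1" using card_image_le[of "{0..D}" "distance_matrix G"] by simp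
  also have "\<dots> = card (E ` {..D})" by (simp add: card_image[OF inj_E])
  finally have "M \<subseteq> span (E ` {..D})"
    using E_in_M by (intro card_ge_dim_independent independent_E) auto
  then have "R \<in> span (E ` {..D})" using assms by blast
  then have "\<exists>r. R = (\<Sum>i\<le>D. r i *\<^sub>R E i)"
  proof (induction rule: span_induct_alt)
    case base
    then show ?case by (intro exI[of _ "\<lambda>_. 0"]) simp
  next
    case (step a S T)
    then obtain j r where j: "j \<le> D" "S = E j" and r: "T = (\<Sum>i\<le>D. r i *\<^sub>R E i)" by auto
    have "(\<Sum>i\<le>D. (if i = j then a else 0) *\<^sub>R E i) = (\<Sum>i\<le>D. if i = j then a *\<^sub>R E i else 0)"
      by (rule sum.cong) auto
    then have "a *\<^sub>R S = (\<Sum>i\<le>D. (if i = j then a else 0) *\<^sub>R E i)" using j by simp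
    then have "a *\<^sub>R S + T = (\<Sum>i\<le>D. ((if i = j then a else 0) + r i) *\<^sub>R E i)"
      using r by (simp add: scaleR_add_left sum.distrib)
    then show ?case by (intro exI[of _ "\<lambda>i. (if i = j then a else 0) + r i"])
  qed
  then show ?thesis using that by blast
qed

lemma mat_1_in_M: "mat 1 \<in> M"
  unfolding M_iff by (intro exI[of _ "\<lambda>i. if i = 0 then 1 else 0"]) (auto simp: mat_def vec_eq_iff)

lemma sum_E: "(\<Sum>i\<le>D. E i) = mat 1"
proof -
  obtain r where r: "mat 1 = (\<Sum>i\<le>D. r i *\<^sub>R E i)" using M_expand[OF mat_1_in_M] by blast
  have "r j = 1" if "j \<le> D" for j
  proof -
    have "r j *\<^sub>R E j = E j" using E_expand_mult[OF that, of r] unfolding r[symmetric] by simp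
    then have "(r j - 1) *\<^sub>R E j = 0" by (simp add: scaleR_left_diff_distrib)
    then show ?thesis using E_nonzero[OF that] by simp
  qed
  then show ?thesis using r by simp
qed

text \<open>Up to the factor \<open>u 0\<close> this is the cosine sequence of \<open>E 1\<close>.
  The choice operator fixes the values at distances up to D only; \<open>u (D + 1)\<close> is
  arbitrary.\<close>

definition u :: "nat \<Rightarrow> real" where
  "u = (SOME f. E 1 = (\<chi> x y. f (d x y)))"

lemma E_1_nth: "E 1 $ x $ y = u (d x y)"
proof -
  have "\<exists>f. E 1 = (\<chi> x y. f (d x y))" using E_in_M[OF diam_pos] unfolding M_iff .
  then have "E 1 = (\<chi> x y. u (d x y))" unfolding u_def by (rule someI_ex)
  then show ?thesis by simp
qed

lemma E_Suc_0_nth [simp]: "E (Suc 0) $ x $ y = u (d x y)"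
  using E_1_nth by simp

lemma E_trace_square: "i \<le> D \<Longrightarrow> E i $ x $ x = (\<Sum>z\<in>UNIV. (E i $ x $ z)\<^sup>2)"
proof -
  assume i: "i \<le> D"
  then have "E i $ x $ x = (\<Sum>z\<in>UNIV. E i $ x $ z * E i $ z $ x)"
    using E_mult[OF i i] matrix_mult_nth[of "E i" "E i" x x] by simp
  then show ?thesis using E_sym[OF i] by (simp add: power2_eq_square)
qed

lemma E_trace_pos: "i \<le> D \<Longrightarrow> 0 < (\<Sum>x\<in>UNIV. E i $ x $ x)"
proof -
  assume i: "i \<le> D"
  then obtain x z where "E i $ x $ z \<noteq> 0" using E_nonzero[OF i] by (auto simp: vec_eq_iff)
  then have "0 < (\<Sum>z\<in>UNIV. (E i $ x $ z)\<^sup>2)" by (intro sum_pos2[of _ z]) auto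
  then have "0 < E i $ x $ x" using E_trace_square[OF i] by simp
  moreover have "0 \<le> E i $ y $ y" for y
    unfolding E_trace_square[OF i] by (intro sum_nonneg) simp
  ultimately show ?thesis by (intro sum_pos2[of _ x]) auto
qed

lemma u_0_pos: "0 < u 0"
  using E_trace_pos[OF diam_pos] by (simp add: zero_less_mult_iff)

text \<open>\<open>E 1\<close> is a symmetric idempotent, so its entries are the inner products of
  its rows, all of squared norm \<open>u 0\<close>. The bound is Cauchy-Schwarz, obtained from the
  squared norms of the difference and the sum of two rows.\<close>

lemma abs_u_le: assumes "i \<le> D" shows "\<bar>u i\<bar> \<le> u 0"
proof -
  obtain x y where xy: "d x y = i" using pair_at_distance assms by blast
  have cross: "u i = (\<Sum>z\<in>UNIV. E 1 $ x $ z * E 1 $ y $ z)"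
    using E_mult[OF diam_pos diam_pos] matrix_mult_nth[of "E 1" "E 1" x y] xy
    by (simp add: dist_commute[of y])
  have sq: "u 0 = (\<Sum>z\<in>UNIV. (E 1 $ x' $ z)\<^sup>2)" for x'
    using E_trace_square[OF diam_pos, of x'] by simp
  have "0 \<le> (\<Sum>z\<in>UNIV. (E 1 $ x $ z - E 1 $ y $ z)\<^sup>2)" by (simp add: sum_nonneg)
  also have "\<dots> = 2 * u 0 - 2 * u i"
    unfolding power2_diff using sq[of x] sq[of y] cross
    by (simp add: sum.distrib sum_subtractf sum_distrib_left mult.assoc)
  finally have 1: "u i \<le> u 0" by simp
  have "0 \<le> (\<Sum>z\<in>UNIV. (E 1 $ x $ z + E 1 $ y $ z)\<^sup>2)" by (simp add: sum_nonneg)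
  also have "\<dots> = 2 * u 0 + 2 * u i"
    unfolding power2_sum using sq[of x] sq[of y] cross
    by (simp add: sum.distrib sum_distrib_left mult.assoc)
  finally show ?thesis using 1 by simp
qed

section \<open>Krein parameters and the injectivity of \<open>u\<close>\<close>

lemma hadamard_nth:
  "i \<le> D \<Longrightarrow> j \<le> D \<Longrightarrow> E i $ x $ y * E j $ x $ y = (\<Sum>h\<le>D. q h i j * E h $ x $ y) / CARD('v)"
proof -
  assume "i \<le> D" "j \<le> D"
  then have "(E i * E j) $ x $ y = ((1 / real CARD('v)) *\<^sub>R (\<Sum>h\<le>D. q h i j *\<^sub>R E h)) $ x $ y"
    using krein by (simp add: krein_parameters_def)
  then show ?thesis by (simp add: sum_component)
qed

text \<open>Orthogonality of the idempotents extracts the coefficient of \<open>E h\<close> from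
  \<open>E i * E j\<close>. The left side is symmetric in i, j, h, which the right side does not
  show.\<close>

lemma triple_hadamard_sum:
  assumes "i \<le> D" "j \<le> D" "h \<le> D"
  shows "(\<Sum>x\<in>UNIV. \<Sum>y\<in>UNIV. E i $ x $ y * E j $ x $ y * E h $ x $ y)
    = q h i j * (\<Sum>x\<in>UNIV. E h $ x $ x) / CARD('v)"
proof -
  have inner: "(\<Sum>y\<in>UNIV. E l $ x $ y * E h $ x $ y) = (if l = h then E h $ x $ x else 0)" if "l \<le> D" for l x
  proof -
    have "(\<Sum>y\<in>UNIV. E l $ x $ y * E h $ x $ y) = (E l ** E h) $ x $ x"
      using E_sym[OF assms(3)] by (simp add: matrix_mult_nth)
    then show ?thesis using E_mult[OF that assms(3)] by simp
  qed
  have "(\<Sum>y\<in>UNIV. E i $ x $ y * E j $ x $ y * E h $ x $ y) = q h i j * E h $ x $ x / CARD('v)" for x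
  proof -
    have "(\<Sum>y\<in>UNIV. E i $ x $ y * E j $ x $ y * E h $ x $ y)
        = (\<Sum>y\<in>UNIV. \<Sum>l\<le>D. q l i j * (E l $ x $ y * E h $ x $ y)) / CARD('v)"
      unfolding hadamard_nth[OF assms(1,2)]
      by (simp add: sum_divide_distrib sum_distrib_right mult.assoc)
    also have "\<dots> = (\<Sum>l\<le>D. q l i j * (\<Sum>y\<in>UNIV. E l $ x $ y * E h $ x $ y)) / CARD('v)"
      by (subst sum.swap) (simp add: sum_distrib_left)
    also have "\<dots> = (\<Sum>l\<le>D. if l = h then q h i j * E h $ x $ x else 0) / CARD('v)"
      by (intro arg_cong2[of _ _ _ _ "(/)"] sum.cong) (auto simp: inner)
    finally show ?thesis using assms(3) by simp
  qed
  then show ?thesis by (simp add: sum_distrib_left sum_divide_distrib)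
qed

text \<open>The Q-polynomial hypothesis speaks of \<open>q 1 h j\<close>, but expanding
  \<open>E 1 * E j\<close> needs \<open>q h 1 j\<close>. The two differ by a ratio of traces, which
  are positive.\<close>

lemma krein_zero_iff:
  assumes "h \<le> D" "j \<le> D"
  shows "q h 1 j = 0 \<longleftrightarrow> q 1 h j = 0"
proof -
  have "(\<Sum>x\<in>UNIV. \<Sum>y\<in>UNIV. E 1 $ x $ y * E j $ x $ y * E h $ x $ y)
      = (\<Sum>x\<in>UNIV. \<Sum>y\<in>UNIV. E h $ x $ y * E j $ x $ y * E 1 $ x $ y)"
    by (simp add: mult_ac)
  then have "q h 1 j * (\<Sum>x\<in>UNIV. E h $ x $ x) = q 1 h j * (\<Sum>x\<in>UNIV. E 1 $ x $ x)"
    unfolding triple_hadamard_sum[OF diam_pos assms(2,1)] triple_hadamard_sum[OF assms diam_pos]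
    by (simp only: divide_cancel_right) simp
  then have "q h 1 j * (\<Sum>x\<in>UNIV. E h $ x $ x) = 0 \<longleftrightarrow> q 1 h j * (\<Sum>x\<in>UNIV. E 1 $ x $ x) = 0"
    by (rule arg_cong)
  then show ?thesis
    unfolding mult_eq_0_iff using E_trace_pos[OF assms(1)] E_trace_pos[OF diam_pos] by linarith
qed

text \<open>By the tridiagonal pattern, \<open>E j\<close> is a polynomial in \<open>E 1\<close> for
  the entrywise product: \<open>E 1 * E (j - 1)\<close> involves \<open>E j\<close> with nonzero
  coefficient and otherwise only earlier idempotents. So if \<open>u\<close> agreed at two
  distances, every matrix in \<open>M\<close> would agree there, contrary to the distance
  matrices.\<close>

lemma u_distinct:
  assumes "h \<le> D" "h' \<le> D" "u h = u h'"
  shows "h = h'"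
proof (rule ccontr)
  assume neq: "h \<noteq> h'"
  obtain x y where xy: "d x y = h" using pair_at_distance assms by blast
  obtain x' y' where xy': "d x' y' = h'" using pair_at_distance assms by blast
  have E_eq: "E j $ x $ y = E j $ x' $ y'" if "j \<le> D" for j
    using that
  proof (induction j rule: less_induct)
    case (less j)
    show ?case
    proof (cases "j \<le> 1")
      case True
      then have "j = 0 \<or> j = 1" by auto
      then show ?thesis using E_0 assms(3) xy xy' E_1_nth by auto
    next
      case False
      define i where "i = j - 1"
      have i: "j = Suc i" "i \<le> D" "1 \<le> i" using False less.prems by (auto simp: i_def)
      have tail: "q l 1 i = 0" if "l \<le> D" "\<not> l \<le> i" "l \<noteq> j" for l
        using krein_zero_iff[OF that(1) i(2)] tridiagonal[OF that(1) i(2)] that i by auto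
      have split: "(\<Sum>l\<le>D. q l 1 i * E l $ a $ b) = (\<Sum>l\<le>i. q l 1 i * E l $ a $ b) + q j 1 i * E j $ a $ b" for a b
      proof -
        have "(\<Sum>l\<le>D. q l 1 i * E l $ a $ b) = (\<Sum>l\<le>j. q l 1 i * E l $ a $ b)"
          using less.prems tail i by (intro sum.mono_neutral_right) auto
        then show ?thesis using i by simp
      qed
      have "(\<Sum>l\<le>D. q l 1 i * E l $ x $ y) = (\<Sum>l\<le>D. q l 1 i * E l $ x' $ y')"
        using hadamard_nth[OF diam_pos i(2), of x y] hadamard_nth[OF diam_pos i(2), of x' y']
          less.IH[of i] i assms(3) xy xy' by simp
      moreover have "(\<Sum>l\<le>i. q l 1 i * E l $ x $ y) = (\<Sum>l\<le>i. q l 1 i * E l $ x' $ y')"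
        using less.IH i by (intro sum.cong) auto
      ultimately have "q j 1 i * E j $ x $ y = q j 1 i * E j $ x' $ y'" unfolding split by simp
      moreover have "q j 1 i \<noteq> 0"
        using krein_zero_iff[OF less.prems i(2)] tridiagonal[OF less.prems i(2)] i by auto
      ultimately show ?thesis by simp
    qed
  qed
  have "distance_matrix G h \<in> M"
    unfolding bose_mesner_def diam using assms(1) by (intro span_base) auto
  then obtain r where "distance_matrix G h = (\<Sum>i\<le>D. r i *\<^sub>R E i)" by (rule M_expand)
  then have nth: "distance_matrix G h $ a $ b = (\<Sum>i\<le>D. r i * E i $ a $ b)" for a b
    by (simp add: sum_component)
  have "distance_matrix G h $ x $ y = distance_matrix G h $ x' $ y'"
    unfolding nth using E_eq by (intro sum.cong) auto
  then show False using xy xy' neq by (simp add: distance_matrix_def)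
qed

end

section \<open>The balanced set condition\<close>

context bipartite_qdrg
begin

text \<open>Up to the factor \<open>|X|\<close>, this is the dual adjacency matrix \<open>A\<^sup>*\<close> with respect to \<open>x\<close>.\<close>

definition dual :: "'v \<Rightarrow> real ^ 'v ^ 'v" where
  "dual x = (\<chi> y z. if y = z then u (d x y) else 0)"

lemma mult_dual_mult_nth:
  "(A ** dual x ** B) $ y $ z = (\<Sum>w\<in>UNIV. A $ y $ w * u (d x w) * B $ w $ z)"
proof -
  have "(A ** dual x) $ y $ w = A $ y $ w * u (d x w)" for w
  proof -
    have "(A ** dual x) $ y $ w = (\<Sum>v\<in>UNIV. if v = w then A $ y $ v * u (d x v) else 0)"
      unfolding matrix_mult_nth by (rule sum.cong) (auto simp: dual_def)
    then show ?thesis by simp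
  qed
  then show ?thesis by (simp add: matrix_mult_nth[of "A ** dual x"])
qed

text \<open>The squared Frobenius norm of \<open>E\<^sub>i A\<^sup>* E\<^sub>j\<close> is
  a positive multiple of \<open>q\<^sup>1\<^sub>i\<^sub>j\<close>.\<close>

lemma triple_product_zero:
  assumes "i \<le> D" "j \<le> D" "q 1 i j = 0"
  shows "E i ** dual x ** E j = 0"
proof -
  let ?T = "E i ** dual x ** E j" and ?a = "\<lambda>w. u (d x w)"
  have gram: "(\<Sum>y\<in>UNIV. E l $ y $ w * E l $ y $ w') = E l $ w $ w'" if "l \<le> D" for l w w'
  proof -
    have "(\<Sum>y\<in>UNIV. E l $ y $ w * E l $ y $ w') = (E l ** E l) $ w $ w'"
      using E_sym[OF that, of _ w] by (simp add: matrix_mult_nth)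
    then show ?thesis using E_mult[OF that that] by simp
  qed
  have "(\<Sum>y\<in>UNIV. \<Sum>z\<in>UNIV. (?T $ y $ z)\<^sup>2)
      = (\<Sum>y\<in>UNIV. \<Sum>z\<in>UNIV. \<Sum>w\<in>UNIV. \<Sum>w'\<in>UNIV.
          ?a w * ?a w' * (E i $ y $ w * E i $ y $ w') * (E j $ w $ z * E j $ w' $ z))"
    unfolding mult_dual_mult_nth power2_eq_square sum_product
    by (intro sum.cong refl) (simp add: mult_ac)
  also have "\<dots> = (\<Sum>w\<in>UNIV. \<Sum>w'\<in>UNIV. \<Sum>y\<in>UNIV. \<Sum>z\<in>UNIV.
          ?a w * ?a w' * (E i $ y $ w * E i $ y $ w') * (E j $ w $ z * E j $ w' $ z))"
  proof -
    have swap4: "(\<Sum>y\<in>UNIV. \<Sum>z\<in>UNIV. \<Sum>w\<in>UNIV. \<Sum>w'\<in>UNIV. f y z w w')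
        = (\<Sum>w\<in>UNIV. \<Sum>w'\<in>UNIV. \<Sum>y\<in>UNIV. \<Sum>z\<in>UNIV. f y z w w')"
      for f :: "'v \<Rightarrow> 'v \<Rightarrow> 'v \<Rightarrow> 'v \<Rightarrow> real"
      by (simp only: sum.cartesian_product) (rule sum.reindex_bij_witness
          [of _ "\<lambda>(w, w', y, z). (y, z, w, w')" "\<lambda>(y, z, w, w'). (w, w', y, z)"]; auto)
    show ?thesis by (rule swap4)
  qed
  also have "\<dots> = (\<Sum>w\<in>UNIV. \<Sum>w'\<in>UNIV. ?a w * ?a w' * (E i $ w $ w' * E j $ w $ w'))"
  proof (intro sum.cong refl)
    fix w w'
    have "(\<Sum>y\<in>UNIV. \<Sum>z\<in>UNIV. ?a w * ?a w' * (E i $ y $ w * E i $ y $ w') * (E j $ w $ z * E j $ w' $ z))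
        = ?a w * ?a w' * (\<Sum>y\<in>UNIV. E i $ y $ w * E i $ y $ w') * (\<Sum>z\<in>UNIV. E j $ z $ w * E j $ z $ w')"
      using E_sym[OF assms(2), of w] E_sym[OF assms(2), of w']
      by (simp add: sum_distrib_left sum_distrib_right mult.assoc) (rule sum.swap)
    then show "(\<Sum>y\<in>UNIV. \<Sum>z\<in>UNIV. ?a w * ?a w' * (E i $ y $ w * E i $ y $ w') * (E j $ w $ z * E j $ w' $ z))
        = ?a w * ?a w' * (E i $ w $ w' * E j $ w $ w')"
      using gram assms by (simp add: mult.assoc)
  qed
  also have "\<dots> = (\<Sum>w\<in>UNIV. \<Sum>w'\<in>UNIV. \<Sum>h\<le>D. q h i j * (?a w * E h $ w $ w' * ?a w')) / CARD('v)"
    unfolding hadamard_nth[OF assms(1,2)] sum_divide_distrib sum_distrib_left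
    by (intro sum.cong refl) (simp add: mult_ac)
  also have "\<dots> = (\<Sum>h\<le>D. q h i j * (\<Sum>w\<in>UNIV. \<Sum>w'\<in>UNIV. ?a w * E h $ w $ w' * ?a w')) / CARD('v)"
    by (subst sum.swap, subst (2) sum.swap, subst sum.swap, simp add: sum_distrib_left,
        rule sum.cong, rule refl, rule sum.swap)
  also have "\<dots> = 0"
  proof -
    \<comment> \<open>For h = 1 the coefficient vanishes by assumption; for other h the double sum
      is a diagonal entry of \<open>E 1 ** (E h ** E 1)\<close>, which is 0.\<close>
    have "q h i j * (\<Sum>w\<in>UNIV. \<Sum>w'\<in>UNIV. ?a w * E h $ w $ w' * ?a w') = 0" if h: "h \<le> D" for h
    proof (cases "h = 1")
      case False
      have "(\<Sum>w\<in>UNIV. \<Sum>w'\<in>UNIV. ?a w * E h $ w $ w' * ?a w')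
          = (\<Sum>w\<in>UNIV. \<Sum>w'\<in>UNIV. E 1 $ x $ w * E h $ w $ w' * E 1 $ w' $ x)"
        by (simp add: dist_commute)
      also have "\<dots> = (E 1 ** (E h ** E 1)) $ x $ x"
        by (simp add: matrix_mult_nth sum_distrib_left mult.assoc)
      also have "E h ** E 1 = 0" using E_mult[OF h diam_pos] False by simp
      finally show ?thesis by (simp add: matrix_mult_nth)
    qed (use assms in simp)
    then have "(\<Sum>h\<le>D. q h i j * (\<Sum>w\<in>UNIV. \<Sum>w'\<in>UNIV. ?a w * E h $ w $ w' * ?a w')) = 0"
      by (intro sum.neutral) blast
    then show ?thesis by simp
  qed
  finally have "(?T $ y $ z)\<^sup>2 = 0" for y z
    by (simp add: sum_nonneg_eq_0_iff sum_nonneg)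
  then show ?thesis by (simp add: vec_eq_iff)
qed

lemma mult_dual_mult_expand:
  "(\<Sum>i\<le>D. r i *\<^sub>R E i) ** dual x ** (\<Sum>j\<le>D. s j *\<^sub>R E j)
    = (\<Sum>i\<le>D. \<Sum>j\<le>D. (r i * s j) *\<^sub>R (E i ** dual x ** E j))"
  unfolding matrix_mult_sum_left matrix_mult_sum_right
  by (subst sum.swap) (simp add: scaleR_sum_right mult.commute)

text \<open>Only the blocks \<open>E i ** dual x ** E j\<close> with |i - j| \<le> 1 survive, and
  diagonal blocks have coefficient 0 on both sides. It remains to solve y_i - y_(i+1) = r_i s_(i+1)
  - s_i r_(i+1), which partial sums do. These coefficients are independent of x, so one Y serves all
  base vertices.\<close>

lemma balanced_commutator:
  assumes "R \<in> M" "S \<in> M"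
  obtains Y where "Y \<in> M" "\<And>x. R ** dual x ** S - S ** dual x ** R = Y ** dual x - dual x ** Y"
proof -
  obtain r where r: "R = (\<Sum>i\<le>D. r i *\<^sub>R E i)" using M_expand[OF assms(1)] by blast
  obtain s where s: "S = (\<Sum>i\<le>D. s i *\<^sub>R E i)" using M_expand[OF assms(2)] by blast
  define y where "y i = - (\<Sum>l<i. r l * s (Suc l) - s l * r (Suc l))" for i
  let ?Y = "\<Sum>i\<le>D. y i *\<^sub>R E i"
  \<comment> \<open>Writing the commutator with \<open>mat 1\<close> as an outer factor brings it
    under \<open>mult_dual_mult_expand\<close> as well.\<close>
  have one: "mat 1 = (\<Sum>i\<le>D. 1 *\<^sub>R E i)" using sum_E by simp
  have "R ** dual x ** S - S ** dual x ** R = ?Y ** dual x - dual x ** ?Y" for x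
  proof -
    have coeff: "(r i * s j - s i * r j) *\<^sub>R (E i ** dual x ** E j) = (y i - y j) *\<^sub>R (E i ** dual x ** E j)"
      if "i \<le> D" "j \<le> D" for i j
    proof -
      consider "i = j" | "j = Suc i" | "i = Suc j" | "i \<noteq> j" "\<bar>int i - int j\<bar> \<noteq> 1" by linarith
      then show ?thesis
      proof cases
        case 4
        then show ?thesis using triple_product_zero[OF that] tridiagonal[OF that] by simp
      qed (auto simp: y_def algebra_simps)
    qed
    have "R ** dual x ** S - S ** dual x ** R
        = (\<Sum>i\<le>D. \<Sum>j\<le>D. (r i * s j - s i * r j) *\<^sub>R (E i ** dual x ** E j))"
      unfolding r s mult_dual_mult_expand by (simp add: sum_subtractf scaleR_diff_left)
    also have "\<dots> = (\<Sum>i\<le>D. \<Sum>j\<le>D. (y i - y j) *\<^sub>R (E i ** dual x ** E j))"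
      using coeff by (intro sum.cong refl) auto
    also have "\<dots> = ?Y ** dual x ** mat 1 - mat 1 ** dual x ** ?Y"
      unfolding one mult_dual_mult_expand by (simp add: sum_subtractf scaleR_diff_left)
    finally show ?thesis by simp
  qed
  moreover have "?Y \<in> M" using E_in_M subspace_M by (auto intro!: subspace_sum subspace_scale)
  ultimately show ?thesis using that by blast
qed

text \<open>This is the (y, z) entry of the commutator identity for two distance matrices. What
  matters is that \<rho> depends on \<open>d y z\<close> but not on the base vertex x.\<close>

lemma balanced_set:
  obtains \<rho> where "\<And>x y z. (\<Sum>w\<in>gsphere G i y \<inter> gsphere G j z. u (d x w))
      - (\<Sum>w\<in>gsphere G j y \<inter> gsphere G i z. u (d x w)) = \<rho> (d y z) * (u (d x z) - u (d x y))"
proof -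
  define A where "A i = (\<chi> x y. if d x y = i then 1 else (0::real))" for i
  have AM: "A i \<in> M" for i unfolding M_iff A_def by (intro exI[of _ "\<lambda>j. if j = i then 1 else 0"]) simp
  obtain Y where Y: "Y \<in> M" "\<And>x. A i ** dual x ** A j - A j ** dual x ** A i = Y ** dual x - dual x ** Y"
    using balanced_commutator[OF AM AM] by blast
  then obtain \<rho> where \<rho>: "Y = (\<chi> x y. \<rho> (d x y))" unfolding M_iff by blast
  have AA: "(A a ** dual x ** A b) $ y $ z = (\<Sum>w\<in>gsphere G a y \<inter> gsphere G b z. u (d x w))" for a b x y z
    unfolding mult_dual_mult_nth
    by (rule sum.mono_neutral_cong_right) (auto simp: A_def gsphere_def dist_commute[of z])
  have "(Y ** dual x) $ y $ z = \<rho> (d y z) * u (d x z)" for x y z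
  proof -
    have "(Y ** dual x) $ y $ z = (\<Sum>v\<in>UNIV. if v = z then \<rho> (d y v) * u (d x v) else 0)"
      unfolding matrix_mult_nth by (rule sum.cong) (auto simp: dual_def \<rho>)
    then show ?thesis by simp
  qed
  moreover have "(dual x ** Y) $ y $ z = u (d x y) * \<rho> (d y z)" for x y z
  proof -
    have "(dual x ** Y) $ y $ z = (\<Sum>v\<in>UNIV. if v = y then u (d x v) * \<rho> (d v z) else 0)"
      unfolding matrix_mult_nth by (rule sum.cong) (auto simp: dual_def \<rho>)
    then show ?thesis by simp
  qed
  ultimately have "(A i ** dual x ** A j - A j ** dual x ** A i) $ y $ z = \<rho> (d y z) * (u (d x z) - u (d x y))" for x y z
    unfolding Y(2) by (simp add: algebra_simps)
  then show ?thesis using that[of \<rho>] by (simp add: AA)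
qed

end

section \<open>The cosine sequence and the design at distance D\<close>

context bipartite_qdrg
begin

lemma u_eigenvector:
  obtains \<theta> where "\<And>x y. (\<Sum>z | G x z. u (d z y)) = \<theta> * u (d x y)"
proof -
  have "distance_matrix G 1 \<in> M"
    unfolding bose_mesner_def diam using diam_pos by (intro span_base) auto
  then obtain r where r: "distance_matrix G 1 = (\<Sum>i\<le>D. r i *\<^sub>R E i)" by (rule M_expand)
  have "(\<Sum>z | G x z. u (d z y)) = r 1 * u (d x y)" for x y
  proof -
    have "(\<Sum>z | G x z. u (d z y)) = (\<Sum>z\<in>UNIV. distance_matrix G 1 $ x $ z * E 1 $ z $ y)"
      by (rule sum.mono_neutral_cong_left) (auto simp: distance_matrix_def dist_eq_Suc_0_iff)
    also have "\<dots> = (distance_matrix G 1 ** E 1) $ x $ y" by (simp add: matrix_mult_nth)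
    also have "distance_matrix G 1 ** E 1 = r 1 *\<^sub>R E 1"
      unfolding r by (rule E_expand_mult[OF diam_pos])
    finally show ?thesis by simp
  qed
  then show ?thesis using that by blast
qed

lemma neighbour_sum:
  assumes "d x y = i" "0 < i"
  shows "(\<Sum>z | G x z. f (d z y)) = real (c i) * f (i - 1) + real (b i) * (f (i + 1) :: real)"
proof -
  have "(\<Sum>z | G x z. f (d z y))
      = (\<Sum>z\<in>{z. G x z \<and> d z y + 1 = i} \<union> {z. G x z \<and> d z y = i + 1}. f (d z y))"
    using neighbours_split[OF assms(1)] by simp
  also have "\<dots> = (\<Sum>z | G x z \<and> d z y + 1 = i. f (d z y)) + (\<Sum>z | G x z \<and> d z y = i + 1. f (d z y))"
    by (rule sum.union_disjoint) auto
  also have "(\<Sum>z | G x z \<and> d z y + 1 = i. f (d z y)) = (\<Sum>z | G x z \<and> d z y + 1 = i. f (i - 1))"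
    by (rule sum.cong) auto
  also have "\<dots> = real (c i) * f (i - 1)"
    using card_closer[OF assms] by simp
  also have "(\<Sum>z | G x z \<and> d z y = i + 1. f (d z y)) = (\<Sum>z | G x z \<and> d z y = i + 1. f (i + 1))"
    by (rule sum.cong) auto
  also have "\<dots> = real (b i) * f (i + 1)"
    using card_farther[OF assms(1)] by simp
  finally show ?thesis .
qed

text \<open>At i = D the arbitrary value \<open>u (D + 1)\<close> occurs, but with the coefficient
  \<open>b D = 0\<close>.\<close>

lemma u_three_term:
  assumes "\<And>x y. (\<Sum>z | G x z. u (d z y)) = \<theta> * u (d x y)" "0 < i" "i \<le> D"
  shows "real (c i) * u (i - 1) + real (b i) * u (i + 1) = \<theta> * u i"
proof -
  obtain x y where xy: "d x y = i" using pair_at_distance[OF assms(3)] by blast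
  show ?thesis using neighbour_sum[OF xy assms(2), of u] assms(1)[where x = x and y = y] xy by simp
qed

lemma u_first_term:
  assumes "\<And>x y. (\<Sum>z | G x z. u (d z y)) = \<theta> * u (d x y)"
  shows "real k * u 1 = \<theta> * u 0"
proof -
  fix x :: 'v
  have "d z x = 1" if "G x z" for z using adj_sym[OF that] dist_eq_1_iff by blast
  then have "(\<Sum>z | G x z. u (d z x)) = (\<Sum>z | G x z. u 1)" by (intro sum.cong) auto
  then show ?thesis using assms[of x x] degree[of x] by simp
qed

text \<open>Put x, y, z on a geodesic with y and z at distance 3. In the balanced set condition for
  radii 1 and 2 each sum is then constant, with values at m + 1 and m + 2. The same \<rho> occurs
  for every m, and comparison with m = 0 eliminates it.\<close>

lemma u_recurrence:
  assumes "m + 3 \<le> D"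
  shows "(u (m + 1) - u (m + 2)) * (u 0 - u 3) = (u 1 - u 2) * (u m - u (m + 3))"
proof -
  obtain \<rho> where \<rho>: "\<And>x y z. (\<Sum>w\<in>gsphere G 1 y \<inter> gsphere G 2 z. u (d x w))
      - (\<Sum>w\<in>gsphere G 2 y \<inter> gsphere G 1 z. u (d x w)) = \<rho> (d y z) * (u (d x z) - u (d x y))"
    using balanced_set[of 1 2] by blast
  have step: "real (p 3 1 2) * u (l + 1) - real (p 3 2 1) * u (l + 2) = \<rho> 3 * (u (l + 3) - u l)"
    if l: "l + 3 \<le> D" for l
  proof -
    obtain x z where xz: "d x z = l + 3" using pair_at_distance[OF l] by blast
    then obtain y where y: "d x y = l" "d y z = 3" using dist_split[of x z l 3] by blast
    have near: "d x w = l + i" if "w \<in> gsphere G i y \<inter> gsphere G (3 - i) z" "i \<le> 3" for w i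
    proof -
      have "d y w = i" "d z w = 3 - i" using that by (auto simp: gsphere_def)
      then show ?thesis
        using dist_triangle[of x w y] dist_triangle[of x z w] dist_commute[of w z] xz y that(2) by linarith
    qed
    have "(\<Sum>w\<in>gsphere G 1 y \<inter> gsphere G 2 z. u (d x w)) = (\<Sum>w\<in>gsphere G 1 y \<inter> gsphere G 2 z. u (l + 1))"
      using near[of _ 1] by (intro sum.cong) auto
    moreover have "(\<Sum>w\<in>gsphere G 2 y \<inter> gsphere G 1 z. u (d x w)) = (\<Sum>w\<in>gsphere G 2 y \<inter> gsphere G 1 z. u (l + 2))"
      using near[of _ 2] by (intro sum.cong) auto
    ultimately show ?thesis using \<rho>[where x = x and y = y and z = z] xz y by (simp add: sphere_inter)
  qed
  have "p 3 2 1 = p 3 1 2"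
  proof -
    obtain x y where "d x y = 3" using pair_at_distance[of 3] assms by auto
    then show ?thesis using sphere_inter[of 1 x 2 y] sphere_inter[of 2 y 1 x]
      by (simp add: dist_commute[of y] Int_commute)
  qed
  moreover have "p 3 1 2 \<noteq> 0" using c_pos[of 3] assms by (simp add: c_def)
  moreover have "u 0 \<noteq> u 3" using u_distinct[of 0 3] assms by auto
  moreover note step[OF assms] step[of 0]
  ultimately have *: "real (p 3 1 2) * (u (m + 1) - u (m + 2)) = \<rho> 3 * (u (m + 3) - u m)"
    "real (p 3 1 2) * (u 1 - u 2) = \<rho> 3 * (u 3 - u 0)" "real (p 3 1 2) \<noteq> 0"
    using assms by (auto simp: algebra_simps numeral_2_eq_2)
  have "real (p 3 1 2) * ((u (m + 1) - u (m + 2)) * (u 0 - u 3))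
      = real (p 3 1 2) * ((u 1 - u 2) * (u m - u (m + 3)))"
    using *(1,2) by algebra
  then show ?thesis using *(3) by simp
qed

text \<open>For vertices \<open>w\<close>, \<open>z\<close> at distance \<open>D\<close>, the neighbours \<open>y\<close> of \<open>w\<close> index blocks
  \<open>{v. G z v \<and> d v y = D - 2}\<close> on the neighbours of \<open>z\<close>. If \<open>c\<^sub>2 = 1\<close>, the balanced set condition
  forces any two blocks to meet in the same number of points, giving a symmetric design.\<close>

lemma opposite_neighbourhoods_design:
  assumes "c 2 = 1" "4 \<le> D"
  obtains n where "(k - 1) * n = c (D - 1) * (c (D - 1) - 1)"
proof -
  obtain w z where wz: "d w z = D" using diam_attained by blast
  obtain x where x: "d w x = 1" "d x z = D - 1"
    using dist_split[of w z 1 "D - 1"] wz assms by auto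
  have Gwx: "G w x" using x dist_eq_1_iff by blast
  let ?N = "{y. G w y}" and ?B = "\<lambda>y. {v. G z v \<and> d v y = D - 2}"
  have card_block: "card (?B y) = c (D - 1)" if "d z y = D - 1" for y
  proof -
    have "?B y = {v. G z v \<and> d v y + 1 = D - 1}" using assms by auto
    then show ?thesis using card_closer[OF that] assms by simp
  qed
  have opp: "d z y = D - 1" if "G w y" for y
    using dist_parity[OF that, of z] dist_le_diam[of z y] wz dist_commute[of w z] by linarith
  have dvw: "d w v = D - 1" if "G z v" for v
    using dist_parity[OF that, of w] dist_le_diam[of w v] wz by linarith
  obtain \<rho> where \<rho>: "\<And>x y z. (\<Sum>w\<in>gsphere G 1 y \<inter> gsphere G (D - 2) z. u (d x w))
      - (\<Sum>w\<in>gsphere G (D - 2) y \<inter> gsphere G 1 z. u (d x w)) = \<rho> (d y z) * (u (d x z) - u (d x y))"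
    using balanced_set[of 1 "D - 2"] by blast
  \<comment> \<open>Balanced set condition with base vertex x for the pair y, z and radii 1 and D -
    2. All terms of one sum are \<open>u 3\<close>; the terms of the other are
    \<open>u (D - 2)\<close> on the block of x and \<open>u D\<close> off it, so the intersection
    size is the only quantity that could vary with y.\<close>
  have inter: "real (card (?B x \<inter> ?B y)) * (u (D - 2) - u D)
      = real (c (D - 1)) * (u 3 - u D) - \<rho> (D - 1) * (u (D - 1) - u 2)" if y: "y \<in> ?N - {x}" for y
  proof -
    have Gwy: "G w y" "x \<noteq> y" using y by auto
    have dxy: "d x y = 2"
      using dist_parity[OF Gwy(1), of x] dist_commute[of x w] x Gwy(2) dist_eq_0_iff[of x y] by linarith
    have far: "d x v = 3" if "v \<in> gsphere G 1 y \<inter> gsphere G (D - 2) z" for v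
    proof -
      have v: "G y v" "d z v = D - 2" using that by (auto simp: gsphere_def dist_eq_Suc_0_iff)
      have "d x v \<noteq> 1"
      proof
        assume "d x v = 1"
        then have "v = w" using unique_common_neighbour[OF assms(1) dxy, of w v]
          dist_eq_1_iff adj_sym v Gwx Gwy by blast
        then show False using v wz dist_commute[of w z] assms by auto
      qed
      then show ?thesis using dist_parity[OF v(1), of x] dxy by linarith
    qed
    have "card (gsphere G 1 y \<inter> gsphere G (D - 2) z) = card (?B y)" (is "card ?F = _")
    proof -
      have "card (gsphere G 1 y \<inter> gsphere G (D - 2) z) = p (D - 1) 1 (D - 2)"
        using sphere_inter opp[OF Gwy(1)] dist_commute by metis
      then show ?thesis using card_block[OF opp[OF Gwy(1)]] by (simp add: c_def numeral_2_eq_2)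
    qed
    moreover have "(\<Sum>v\<in>?F. u (d x v)) = (\<Sum>v\<in>?F. u 3)"
      using far by (intro sum.cong) auto
    ultimately have first: "(\<Sum>v\<in>?F. u (d x v)) = real (c (D - 1)) * u 3"
      using card_block[OF opp[OF Gwy(1)]] by simp
    have block: "gsphere G (D - 2) y \<inter> gsphere G 1 z = ?B y"
      by (auto simp: gsphere_def dist_eq_Suc_0_iff dist_commute[of y])
    have "(\<Sum>v\<in>?B y. u (d x v)) = (\<Sum>v\<in>?B y. u D + (if v \<in> ?B x then u (D - 2) - u D else 0))"
    proof (rule sum.cong)
      fix v assume v: "v \<in> ?B y"
      then have "d x v = D - 1 + 1 \<or> D - 1 = d x v + 1"
        using dist_parity[of z v x] x by simp
      then show "u (d x v) = u D + (if v \<in> ?B x then u (D - 2) - u D else 0)"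
        using v assms dist_commute[of x v] by (auto simp: numeral_2_eq_2)
    qed simp
    also have "\<dots> = (\<Sum>v\<in>?B y. u D) + (\<Sum>v\<in>?B y. if v \<in> ?B x then u (D - 2) - u D else 0)"
      by (rule sum.distrib)
    also have "(\<Sum>v\<in>?B y. if v \<in> ?B x then u (D - 2) - u D else 0)
        = (\<Sum>v\<in>?B x \<inter> ?B y. u (D - 2) - u D)"
      by (rule sum.mono_neutral_cong_right) auto
    also have "(\<Sum>v\<in>?B y. u D) + \<dots>
        = real (c (D - 1)) * u D + real (card (?B x \<inter> ?B y)) * (u (D - 2) - u D)"
      using card_block[OF opp[OF Gwy(1)]] by simp
    finally show ?thesis
      using \<rho>[where x = x and y = y and z = z] first block dxy x opp[OF Gwy(1)] dist_commute[of y z]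
      by (simp add: algebra_simps)
  qed
  have "u (D - 2) \<noteq> u D" using u_distinct[of "D - 2" D] assms by auto
  then have const: "card (?B x \<inter> ?B y) = card (?B x \<inter> ?B y')"
    if "y \<in> ?N - {x}" "y' \<in> ?N - {x}" for y y'
  proof -
    have "real (card (?B x \<inter> ?B y)) * (u (D - 2) - u D) = real (card (?B x \<inter> ?B y')) * (u (D - 2) - u D)"
      using inter[OF that(1)] inter[OF that(2)] by (simp only:)
    then show ?thesis using \<open>u (D - 2) \<noteq> u D\<close> by (simp only: mult_cancel_right) simp
  qed
  obtain n where n: "\<And>y. y \<in> ?N - {x} \<Longrightarrow> card (?B x \<inter> ?B y) = n"
  proof (cases "?N - {x} = {}")
    case True
    then show ?thesis using that[of 0] by (metis empty_iff)
  next
    case False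
    then obtain y' where y': "y' \<in> ?N - {x}" by blast
    show ?thesis by (rule that) (rule const[OF _ y'])
  qed
  \<comment> \<open>Count pairs (y, v) with y distinct from x and v in both blocks. Each v lies in
    \<open>c (D - 1)\<close> blocks, one of which is the block of x.\<close>
  have "(k - 1) * n = (\<Sum>y\<in>?N - {x}. card (?B x \<inter> ?B y))"
    using n degree[of w] Gwx by simp
  also have "\<dots> = (\<Sum>y\<in>?N - {x}. \<Sum>v\<in>?B x. if d v y = D - 2 then 1 else 0)"
  proof (rule sum.cong[OF refl])
    fix y
    have "?B x \<inter> ?B y = {v \<in> ?B x. d v y = D - 2}" by auto
    then show "card (?B x \<inter> ?B y) = (\<Sum>v\<in>?B x. if d v y = D - 2 then 1 else 0)"
      by (simp only: card_eq_sum sum.inter_filter finite)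
  qed
  also have "\<dots> = (\<Sum>v\<in>?B x. \<Sum>y\<in>?N - {x}. if d v y = D - 2 then 1 else 0)"
    by (rule sum.swap)
  also have "\<dots> = (\<Sum>v\<in>?B x. c (D - 1) - 1)"
  proof (rule sum.cong)
    fix v assume v: "v \<in> ?B x"
    have "(\<Sum>y\<in>?N - {x}. if d v y = D - 2 then 1 else 0) = card ({y. G w y \<and> d v y = D - 2} - {x})"
      by (simp add: sum.If_cases) (rule arg_cong[of _ _ card], auto)
    also have "\<dots> = card {y. G w y \<and> d v y = D - 2} - 1"
      using v Gwx by (subst card_Diff_singleton) auto
    also have "{y. G w y \<and> d v y = D - 2} = {y. G w y \<and> d y v + 1 = D - 1}"
      using assms by (auto simp: dist_commute[of v])
    finally show "(\<Sum>y\<in>?N - {x}. if d v y = D - 2 then 1 else 0) = c (D - 1) - 1"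
      using card_closer[OF dvw] v assms by simp
  qed simp
  also have "\<dots> = c (D - 1) * (c (D - 1) - 1)"
    using card_block opp[OF Gwx] by simp
  finally show ?thesis using that by blast
qed

end

section \<open>Numerical constraints\<close>

text \<open>The hypotheses are the eigenvalue relations with \<kappa> = k - 1 and c_1 = c_2 = 1.
  Denominators are cleared, and the differences then show the common factor k - \<theta>.\<close>

lemma cosine_values:
  fixes u1 u2 u3 \<kappa> \<theta> :: real
  assumes "(\<kappa> + 1) * u1 = \<theta>" "1 + \<kappa> * u2 = \<theta> * u1" "u1 + \<kappa> * u3 = \<theta> * u2"
  shows "u2 * ((\<kappa> + 1) * \<kappa>) = \<theta>\<^sup>2 - (\<kappa> + 1)"
    and "u3 * ((\<kappa> + 1) * \<kappa>\<^sup>2) = \<theta> * (\<theta>\<^sup>2 - 2 * \<kappa> - 1)"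
    and "(u1 - u2) * ((\<kappa> + 1) * \<kappa>) = (\<kappa> + 1 - \<theta>) * (\<theta> + 1)"
    and "(u2 - u3) * ((\<kappa> + 1) * \<kappa>\<^sup>2) = (\<kappa> + 1 - \<theta>) * (\<theta>\<^sup>2 + \<theta> - \<kappa>)"
    and "(1 - u3) * ((\<kappa> + 1) * \<kappa>\<^sup>2) = (\<kappa> + 1 - \<theta>) * (\<theta>\<^sup>2 + (\<kappa> + 1) * \<theta> + \<kappa>\<^sup>2)"
proof -
  show u2: "u2 * ((\<kappa> + 1) * \<kappa>) = \<theta>\<^sup>2 - (\<kappa> + 1)"
  proof -
    have "u2 * ((\<kappa> + 1) * \<kappa>) = (\<kappa> + 1) * (\<kappa> * u2)" by simp
    also have "\<kappa> * u2 = \<theta> * u1 - 1" using assms(2) by simp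
    also have "(\<kappa> + 1) * (\<theta> * u1 - 1) = \<theta> * ((\<kappa> + 1) * u1) - (\<kappa> + 1)" by (simp add: algebra_simps)
    finally show ?thesis unfolding assms(1) by (simp add: power2_eq_square)
  qed
  show u3: "u3 * ((\<kappa> + 1) * \<kappa>\<^sup>2) = \<theta> * (\<theta>\<^sup>2 - 2 * \<kappa> - 1)"
  proof -
    have "u3 * ((\<kappa> + 1) * \<kappa>\<^sup>2) = (\<kappa> + 1) * \<kappa> * (\<kappa> * u3)" by (simp add: power2_eq_square)
    also have "\<kappa> * u3 = \<theta> * u2 - u1" using assms(3) by simp
    also have "(\<kappa> + 1) * \<kappa> * (\<theta> * u2 - u1) = \<theta> * (u2 * ((\<kappa> + 1) * \<kappa>)) - \<kappa> * ((\<kappa> + 1) * u1)"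
      by (simp add: algebra_simps)
    finally show ?thesis unfolding assms(1) u2 by (simp add: algebra_simps)
  qed
  have "(u1 - u2) * ((\<kappa> + 1) * \<kappa>) = (\<kappa> + 1) * u1 * \<kappa> - u2 * ((\<kappa> + 1) * \<kappa>)"
    by (simp add: algebra_simps)
  then show "(u1 - u2) * ((\<kappa> + 1) * \<kappa>) = (\<kappa> + 1 - \<theta>) * (\<theta> + 1)"
    unfolding assms(1) u2 by (simp add: algebra_simps power2_eq_square)
  have "(u2 - u3) * ((\<kappa> + 1) * \<kappa>\<^sup>2) = (u2 * ((\<kappa> + 1) * \<kappa>)) * \<kappa> - u3 * ((\<kappa> + 1) * \<kappa>\<^sup>2)"
    by (simp add: algebra_simps power2_eq_square)
  then show "(u2 - u3) * ((\<kappa> + 1) * \<kappa>\<^sup>2) = (\<kappa> + 1 - \<theta>) * (\<theta>\<^sup>2 + \<theta> - \<kappa>)"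
    unfolding u2 u3 by (simp add: algebra_simps power2_eq_square)
  show "(1 - u3) * ((\<kappa> + 1) * \<kappa>\<^sup>2) = (\<kappa> + 1 - \<theta>) * (\<theta>\<^sup>2 + (\<kappa> + 1) * \<theta> + \<kappa>\<^sup>2)"
    unfolding left_diff_distrib u3 by (simp add: algebra_simps power2_eq_square)
qed

text \<open>The recurrence ties \<open>u4\<close> to the first three cosines, which turns the
  eigenvalue relation at distance 3 into an equation linear in \<open>c3\<close>.\<close>

lemma third_intersection_number:
  fixes u1 u2 u3 u4 k \<theta> c3 :: real
  assumes "2 < k" "\<bar>\<theta>\<bar> < k" "\<theta> \<noteq> - 1"
    and "k * u1 = \<theta>" "1 + (k - 1) * u2 = \<theta> * u1" "u1 + (k - 1) * u3 = \<theta> * u2"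
    and c3: "c3 * u2 + (k - c3) * u4 = \<theta> * u3"
    and rec: "(u2 - u3) * (1 - u3) = (u1 - u2) * (u1 - u4)"
  shows "(c3 - 1) * ((k - 1) * (\<theta> + k - 1) - (\<theta> + 1) * \<theta>\<^sup>2) = (k - 1)\<^sup>2 * (k - 2)"
proof -
  define \<kappa> where "\<kappa> = k - 1"
  have k: "k = \<kappa> + 1" and \<kappa>: "0 < \<kappa>" using assms(1) by (auto simp: \<kappa>_def)
  let ?N = "\<theta>\<^sup>2 + k * \<theta> + \<kappa>\<^sup>2" and ?e = "\<theta>\<^sup>2 + \<theta> - \<kappa>"
  have k\<theta>: "0 < k - \<theta>" "0 < k + \<theta>" using assms(2) by auto
  have u2k: "u2 * (k * \<kappa>) = \<theta>\<^sup>2 - k"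
    and u3k: "u3 * (k * \<kappa>\<^sup>2) = \<theta> * (\<theta>\<^sup>2 - 2 * k + 1)"
    and d1: "(u1 - u2) * (k * \<kappa>) = (k - \<theta>) * (\<theta> + 1)"
    and d2: "(u2 - u3) * (k * \<kappa>\<^sup>2) = (k - \<theta>) * ?e"
    and d3: "(1 - u3) * (k * \<kappa>\<^sup>2) = (k - \<theta>) * ?N"
    using cosine_values[of \<kappa> u1 \<theta> u2 u3] assms(4-6) by (simp_all add: \<kappa>_def algebra_simps)
  have u14: "(u1 - u4) * (k * \<kappa> ^ 3 * (\<theta> + 1)) = (k - \<theta>) * ?e * ?N"
  proof -
    have "(k - \<theta>) * ((u1 - u4) * (k * \<kappa> ^ 3 * (\<theta> + 1)))
        = ((k - \<theta>) * (\<theta> + 1)) * (u1 - u4) * (k * \<kappa> ^ 3)" by simp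
    also have "\<dots> = (u1 - u2) * (u1 - u4) * (k * \<kappa>\<^sup>2) * (k * \<kappa>\<^sup>2)"
      unfolding d1[symmetric] by (simp add: power2_eq_square power3_eq_cube)
    also have "\<dots> = ((u2 - u3) * (k * \<kappa>\<^sup>2)) * ((1 - u3) * (k * \<kappa>\<^sup>2))"
      unfolding rec[symmetric] by simp
    also have "\<dots> = (k - \<theta>) * ((k - \<theta>) * ?e * ?N)" unfolding d2 d3 by simp
    finally show ?thesis using k\<theta> by simp
  qed
  have u1': "u1 * (k * \<kappa> ^ 3 * (\<theta> + 1)) = \<kappa> ^ 3 * (\<theta> + 1) * \<theta>"
    unfolding assms(4)[symmetric] by simp
  have u4: "u4 * (k * \<kappa> ^ 3 * (\<theta> + 1)) = \<kappa> ^ 3 * (\<theta> + 1) * \<theta> - (k - \<theta>) * ?e * ?N"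
    using u14 u1' unfolding left_diff_distrib by linarith
  have u2': "u2 * (k * \<kappa> ^ 3 * (\<theta> + 1)) = \<kappa>\<^sup>2 * (\<theta> + 1) * (\<theta>\<^sup>2 - k)"
    unfolding u2k[symmetric] by (simp add: power2_eq_square power3_eq_cube)
  have u3': "u3 * (k * \<kappa> ^ 3 * (\<theta> + 1)) = \<kappa> * (\<theta> + 1) * \<theta> * (\<theta>\<^sup>2 - 2 * k + 1)"
  proof -
    have "u3 * (k * \<kappa> ^ 3 * (\<theta> + 1)) = \<kappa> * (\<theta> + 1) * (u3 * (k * \<kappa>\<^sup>2))"
      by (simp add: power2_eq_square power3_eq_cube)
    then show ?thesis unfolding u3k by simp
  qed
  let ?W = "\<kappa> ^ 3 * (\<theta> + 1) * \<theta> - (k - \<theta>) * ?e * ?N"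
  have "c3 * (u2 * (k * \<kappa> ^ 3 * (\<theta> + 1))) + (k - c3) * (u4 * (k * \<kappa> ^ 3 * (\<theta> + 1)))
      = \<theta> * (u3 * (k * \<kappa> ^ 3 * (\<theta> + 1)))"
    using c3 by algebra
  then have "c3 * (\<kappa>\<^sup>2 * (\<theta> + 1) * (\<theta>\<^sup>2 - k)) + (k - c3) * ?W
      = \<theta> * (\<kappa> * (\<theta> + 1) * \<theta> * (\<theta>\<^sup>2 - 2 * k + 1))"
    unfolding u2' u3' u4 .
  \<comment> \<open>The cleared equation is divisible by k^2 - \<theta>^2, which is nonzero because
    |\<theta>| < k.\<close>
  then have "(k - \<theta>) * (k + \<theta>) * ((c3 - 1) * (\<kappa> * (\<theta> + \<kappa>) - (\<theta> + 1) * \<theta>\<^sup>2) - \<kappa>\<^sup>2 * (\<kappa> - 1)) = 0"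
    unfolding k by algebra
  then have "(c3 - 1) * (\<kappa> * (\<theta> + \<kappa>) - (\<theta> + 1) * \<theta>\<^sup>2) = \<kappa>\<^sup>2 * (\<kappa> - 1)"
    using k\<theta> by simp
  then show ?thesis by (simp add: \<kappa>_def add_diff_eq)
qed

text \<open>The right side of \<open>c3\<close> is positive, so both factors on the left are. For
  \<theta> > -1 the bound 2 c_3 \<le> k demands a larger second factor than is possible; for
  \<theta> < 1 - k that factor exceeds the right side, which puts c_3 strictly between 1 and
  2.\<close>

lemma eigenvalue_range:
  fixes k \<theta> :: real and c3 :: nat
  assumes "3 \<le> k" "\<bar>\<theta>\<bar> < k" "\<theta> \<noteq> - 1" "1 \<le> c3" "2 * real c3 \<le> k"
    and c3: "(real c3 - 1) * ((k - 1) * (\<theta> + k - 1) - (\<theta> + 1) * \<theta>\<^sup>2) = (k - 1)\<^sup>2 * (k - 2)"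
      (is "_ * ?R = _")
  shows "1 - k \<le> \<theta> \<and> \<theta> < - 1"
proof -
  have pos: "0 < (real c3 - 1) * ?R" unfolding c3 using assms(1) by simp
  then have c1: "1 < real c3" and R: "0 < ?R"
    using assms(4) by (auto simp: zero_less_mult_iff)
  have "\<theta> < - 1"
  proof (rule ccontr)
    assume "\<not> \<theta> < - 1"
    then have \<theta>: "- 1 < \<theta>" using assms(3) by simp
    have "(k - 1)\<^sup>2 * (k - 2) * 2 = (2 * (real c3 - 1)) * ?R"
      unfolding c3[symmetric] by (simp only: mult_ac)
    also have "\<dots> \<le> (k - 2) * ?R" using assms(5) R by (intro mult_right_mono) auto
    finally have "(k - 2) * (2 * (k - 1)\<^sup>2) \<le> (k - 2) * ?R" by (simp only: mult_ac)
    then have "2 * (k - 1)\<^sup>2 \<le> ?R" using assms(1) by (simp only: mult_le_cancel_left_pos)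
    then have *: "(k - 1) * k \<le> (\<theta> + 1) * (k - 1 - \<theta>\<^sup>2)" by (simp add: algebra_simps power2_eq_square)
    have "0 < (k - 1) * k" using assms(1) by simp
    then have "0 < (\<theta> + 1) * (k - 1 - \<theta>\<^sup>2)" using * by linarith
    then have sq: "\<theta>\<^sup>2 < k - 1" using \<theta> by (simp add: zero_less_mult_iff)
    have "\<theta> < k - 1"
    proof (rule ccontr)
      assume "\<not> \<theta> < k - 1"
      then have "(k - 1) * 1 \<le> \<theta> * \<theta>" using assms(1) by (intro mult_mono) auto
      then show False using sq by (simp add: power2_eq_square)
    qed
    then have "(\<theta> + 1) * (k - 1 - \<theta>\<^sup>2) < k * (k - 1)"
      using \<theta> sq by (intro mult_less_le_imp_less) auto
    then show False using * by (simp add: mult.commute)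
  qed
  moreover have "1 - k \<le> \<theta>"
  proof (rule ccontr)
    assume "\<not> 1 - k \<le> \<theta>"
    define t where "t = 1 - k - \<theta>"
    have t: "0 < t" "\<theta> = 1 - k - t" using \<open>\<not> 1 - k \<le> \<theta>\<close> by (auto simp: t_def)
    have "?R - (k - 1)\<^sup>2 * (k - 2) = t * ((k - 2) * (2 * (k - 1) + t) + ((k - 1 + t)\<^sup>2 - (k - 1)))"
      unfolding t(2) by (simp add: algebra_simps power2_eq_square)
    moreover have "0 < \<dots>"
    proof -
      have "(k - 1) * 1 < (k - 1 + t) * (k - 1 + t)" using assms(1) t(1) by (intro mult_strict_mono) auto
      then have "0 < (k - 1 + t)\<^sup>2 - (k - 1)" by (simp add: power2_eq_square)
      moreover have "0 \<le> (k - 2) * (2 * (k - 1) + t)" using assms(1) t(1) by simp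
      ultimately show ?thesis using t(1) by (intro mult_pos_pos) auto
    qed
    ultimately have "(k - 1)\<^sup>2 * (k - 2) < ?R" by simp
    then have "(real c3 - 1) * ?R < 1 * ?R" using c3 by simp
    then have "real c3 < 2" using R by (simp add: mult_less_cancel_right)
    then show False using c1 by simp
  qed
  ultimately show ?thesis by simp
qed

text \<open>Applied with \<open>\<kappa> = k - 1\<close>, \<open>P = p\<^sup>D\<close> and \<open>b = b\<^sub>D\<^sub>-\<^sub>1\<close>, where \<open>q = -p\<close> is the base of the
  \<open>Q\<close>-polynomial structure. The assumptions \<open>A\<close> and \<open>B\<close> are two expressions for \<open>k\<close>; one holds
  because \<open>c\<^sub>1 = c\<^sub>2 = 1\<close>, the other because \<open>b\<^sub>D = 0\<close>.\<close>

lemma end_valency_square_le: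
  fixes p P \<omega> \<kappa> b :: real
  assumes p: "1 < p" and P: "p ^ 7 \<le> P" and \<omega>: "0 < \<omega>" and small: "\<omega> * P < p"
    and A: "\<kappa> * \<omega> * (p - 1) * (p + 1)\<^sup>2 = p * (1 - \<omega>) * (1 + \<omega> * p)"
    and B: "\<kappa> * (p + 1) * (1 + \<omega> * P) = (P - p) * (1 - \<omega>)"
    and b: "b * (1 + \<omega> * P) * (p ^ 3 + \<omega> * P\<^sup>2) = (1 + \<omega> * p) * (p\<^sup>2 + \<omega> * P) * P"
  shows "b\<^sup>2 \<le> \<kappa> + 1"
proof -
  define w where "w = \<omega> * P"
  define \<epsilon> where "\<epsilon> = \<omega> * p"
  define Q where "Q = p\<^sup>2 - p - 1"
  have p7: "1 < p ^ 7" using p by (simp add: one_less_power)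
  then have P0: "1 < P" "0 < P" using P by auto
  have w: "0 < w" "w < p" using \<omega> small P0 by (auto simp: w_def)
  have \<epsilon>0: "0 < \<epsilon>" using \<omega> p by (simp add: \<epsilon>_def)
  have \<epsilon>p3: "\<epsilon> * p ^ 3 \<le> 1"
  proof -
    have "\<omega> * p ^ 7 \<le> \<omega> * P" using P \<omega> by simp
    then have "\<omega> * p ^ 7 < p" using small by simp
    then have "(\<omega> * p ^ 6) * p < 1 * p" by (simp add: eval_nat_numeral mult_ac)
    then have *: "\<omega> * p ^ 6 < 1" using p by (simp only: mult_less_cancel_right)
    have "\<epsilon> * p ^ 3 = \<omega> * p ^ 4" by (simp add: \<epsilon>_def eval_nat_numeral mult_ac)
    also have "\<dots> \<le> \<omega> * p ^ 6" using p \<omega> by (intro mult_left_mono power_increasing) auto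
    finally show ?thesis using * by simp
  qed
  have \<omega>1: "\<omega> < 1"
  proof -
    have "\<omega> = \<omega> * 1" by simp
    also have "\<dots> \<le> \<epsilon> * p ^ 3"
      unfolding \<epsilon>_def mult.assoc using p \<omega> one_le_power[of p 4]
      by (intro mult_left_mono) (auto simp: eval_nat_numeral mult_ac)
    finally have "\<omega> \<le> 1" using \<epsilon>p3 by simp
    moreover have "\<omega> \<noteq> 1" using small P p7 p power_increasing[of 1 7 p] by auto
    ultimately show ?thesis by simp
  qed
  \<comment> \<open>Eliminate \<kappa> between \<open>A\<close> and \<open>B\<close>, then cancel 1
    - \<omega>.\<close>
  have C: "(w - \<epsilon>) * (p\<^sup>2 - 1) = p * (1 + \<epsilon>) * (1 + w)"
  proof -
    have "(1 - \<omega>) * ((w - \<epsilon>) * (p\<^sup>2 - 1)) = (1 - \<omega>) * (p * (1 + \<epsilon>) * (1 + w))"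
      using A B unfolding w_def \<epsilon>_def by algebra
    then show ?thesis using \<omega>1 by simp
  qed
  have wQ: "p \<le> w * Q"
  proof -
    have "w * Q - p = \<epsilon> * (p\<^sup>2 - 1) + p * \<epsilon> * (1 + w)"
      using C unfolding Q_def by (simp add: algebra_simps)
    moreover have "0 \<le> \<epsilon> * (p\<^sup>2 - 1) + p * \<epsilon> * (1 + w)"
      using \<epsilon>0 p w by (intro add_nonneg_nonneg mult_nonneg_nonneg) auto
    ultimately show ?thesis by simp
  qed
  then have Q0: "0 < Q" using w p by (smt (verit) mult_nonneg_nonpos)
  have pw: "p\<^sup>2 + w \<le> w * ((p - 1)\<^sup>2 * (p + 1))"
  proof -
    have "p * p \<le> p * (w * Q)" using wQ p by (intro mult_left_mono) auto
    then show ?thesis unfolding Q_def by (simp add: algebra_simps power2_eq_square)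
  qed
  have cube: "(1 + \<epsilon>) * (p ^ 3 - 2 * p\<^sup>2 + 1) \<le> p ^ 3"
  proof -
    have p2: "1 \<le> p\<^sup>2" using p by simp
    have "\<epsilon> * (p ^ 3 - 2 * p\<^sup>2 + 1) \<le> \<epsilon> * p ^ 3" using \<epsilon>0 p2 by (intro mult_left_mono) auto
    also have "\<dots> \<le> 2 * p\<^sup>2 - 1" using \<epsilon>p3 p2 by simp
    finally show ?thesis by (simp add: algebra_simps)
  qed
  \<comment> \<open>The source of the exponent 7: the polynomial has degree 3 + 2 + 2 in p, and (p -
    1) Q = p^3 - 2 p^2 + 1 leaves enough room to absorb 1 + \<epsilon>.\<close>
  have p47: "(1 + \<epsilon>) * ((p - 1) ^ 3 * (p + 1)\<^sup>2 * Q) \<le> p ^ 7"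
  proof -
    have "(1 + \<epsilon>) * ((p - 1) ^ 3 * (p + 1)\<^sup>2 * Q) = (p\<^sup>2 - 1)\<^sup>2 * ((1 + \<epsilon>) * (p ^ 3 - 2 * p\<^sup>2 + 1))"
      unfolding Q_def by algebra
    also have "\<dots> \<le> (p\<^sup>2 - 1)\<^sup>2 * p ^ 3" using cube by (intro mult_left_mono) auto
    also have "\<dots> \<le> (p\<^sup>2)\<^sup>2 * p ^ 3" using p by (intro mult_right_mono power_mono) auto
    also have "\<dots> = p ^ 7" by (simp add: eval_nat_numeral mult_ac)
    finally show ?thesis .
  qed
  have main: "(p + 1) * (1 + \<epsilon>) * (p\<^sup>2 + w)\<^sup>2 \<le> (1 + w) * w\<^sup>2 * p ^ 7"
  proof -
    have "(p + 1) * (1 + \<epsilon>) * (p\<^sup>2 + w)\<^sup>2 * Q \<le> (p + 1) * (1 + \<epsilon>) * (w * ((p - 1)\<^sup>2 * (p + 1)))\<^sup>2 * Q"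
      using pw w p \<epsilon>0 Q0 by (intro mult_right_mono mult_left_mono power_mono) auto
    also have "\<dots> = w\<^sup>2 * (p\<^sup>2 - 1) * ((1 + \<epsilon>) * ((p - 1) ^ 3 * (p + 1)\<^sup>2 * Q))" by algebra
    also have "\<dots> \<le> w\<^sup>2 * (p\<^sup>2 - 1) * p ^ 7"
      using p47 p by (intro mult_left_mono) auto
    also have "\<dots> \<le> w\<^sup>2 * ((1 + w) * Q) * p ^ 7"
      using wQ p unfolding Q_def by (intro mult_right_mono mult_left_mono) (auto simp: algebra_simps)
    finally have "(p + 1) * (1 + \<epsilon>) * (p\<^sup>2 + w)\<^sup>2 * Q \<le> (1 + w) * w\<^sup>2 * p ^ 7 * Q"
      by (simp add: mult_ac)
    then show ?thesis using Q0 by simp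
  qed
  \<comment> \<open>The claim with denominators cleared and a factor 1 + \<epsilon> removed. After
    dropping p^3 beside w P, it follows from \<open>main\<close> and p^7 \<le> 1 + P.\<close>
  have key: "(p + 1) * (1 + \<epsilon>) * (p\<^sup>2 + w)\<^sup>2 * P\<^sup>2 \<le> (1 + P) * (1 + w) * (p ^ 3 + w * P)\<^sup>2"
  proof -
    have "(p + 1) * (1 + \<epsilon>) * (p\<^sup>2 + w)\<^sup>2 * P\<^sup>2 \<le> (1 + w) * w\<^sup>2 * p ^ 7 * P\<^sup>2"
      using main by (intro mult_right_mono) auto
    also have "\<dots> \<le> (1 + w) * w\<^sup>2 * (1 + P) * P\<^sup>2"
      using P w by (intro mult_right_mono mult_left_mono) auto
    also have "\<dots> = (1 + P) * (1 + w) * (w * P)\<^sup>2" by (simp add: power_mult_distrib)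
    also have "\<dots> \<le> (1 + P) * (1 + w) * (p ^ 3 + w * P)\<^sup>2"
      using P0 w p by (intro mult_left_mono power_mono) auto
    finally show ?thesis .
  qed
  let ?Z = "(p + 1) * (1 + w)\<^sup>2 * (p ^ 3 + w * P)\<^sup>2"
  have Z: "0 < ?Z" using p w P0 by (intro mult_pos_pos zero_less_power add_pos_pos) auto
  have k: "(\<kappa> + 1) * ((p + 1) * (1 + w)) = (1 + P) * (1 + \<epsilon>)"
    using B unfolding w_def \<epsilon>_def by algebra
  have b': "b * (1 + w) * (p ^ 3 + w * P) = (1 + \<epsilon>) * (p\<^sup>2 + w) * P"
    using b unfolding w_def \<epsilon>_def by (simp add: power2_eq_square mult_ac)
  have "b\<^sup>2 * ?Z = (p + 1) * (b * (1 + w) * (p ^ 3 + w * P))\<^sup>2" by (simp add: power_mult_distrib)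
  also have "\<dots> = (1 + \<epsilon>) * ((p + 1) * (1 + \<epsilon>) * (p\<^sup>2 + w)\<^sup>2 * P\<^sup>2)"
    unfolding b' by (simp add: power_mult_distrib power2_eq_square[of "1 + \<epsilon>"])
  also have "\<dots> \<le> (1 + \<epsilon>) * ((1 + P) * (1 + w) * (p ^ 3 + w * P)\<^sup>2)"
    using key \<epsilon>0 by (intro mult_left_mono) auto
  also have "\<dots> = ((1 + P) * (1 + \<epsilon>)) * (1 + w) * (p ^ 3 + w * P)\<^sup>2" by simp
  also have "\<dots> = (\<kappa> + 1) * ?Z"
    unfolding k[symmetric] by (simp add: power2_eq_square[of "1 + w"])
  finally show ?thesis using Z by (simp only: mult_le_cancel_right_pos)
qed

text \<open>The normalised differences \<open>G i\<close> satisfy \<open>G (i + 2) = B * G (i + 1) - G i\<close> with \<open>B \<ge> 2\<close>, and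
  \<open>F\<close> is the invariant quadratic form of this recurrence. Its positivity makes \<open>G\<close> decreasing; the
  sign conditions at the far end then exclude even \<open>D\<close>. For \<open>B = p + 1 / p\<close> with \<open>p > 1\<close>, \<open>G i\<close> is
  proportional to \<open>p\<^sup>-\<^sup>i - \<omega> p\<^sup>i\<close>.\<close>

lemma negative_eigenvalue_contradiction:
  fixes u :: "nat \<Rightarrow> real" and \<kappa> y b :: real
  assumes \<kappa>: "2 \<le> \<kappa>" and y: "0 < y" "y \<le> \<kappa> - 1" and D: "6 \<le> D"
    and u0: "u 0 = 1" and u1: "(\<kappa> + 1) * u 1 = - (1 + y)"
    and u2: "1 + \<kappa> * u 2 = - (1 + y) * u 1" and u3: "u 1 + \<kappa> * u 3 = - (1 + y) * u 2"
    and rec: "\<And>m. m + 3 \<le> D \<Longrightarrow> (u (m + 1) - u (m + 2)) * (u 0 - u 3) = (u 1 - u 2) * (u m - u (m + 3))"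
    and uD1: "(\<kappa> + 1 - b) * u (D - 2) + b * u D = - (1 + y) * u (D - 1)"
    and uD: "(\<kappa> + 1) * u (D - 1) = - (1 + y) * u D" "u D < 1"
    and b: "1 \<le> b" "1 < b \<Longrightarrow> 2 \<le> b \<and> \<kappa> \<le> b * (b - 1)"
  shows False
proof -
  \<comment> \<open>Here \<theta> = -(1 + y) and \<kappa> = k - 1. It will turn out that \<nu> = 1 -
    u 1, that r = \<open>G 1\<close>, that u (i + 3) - u i = (B - 1) (u (i + 1) - u (i + 2)), and
    that F = 1 - B r + r^2.\<close>
  define \<nu> where "\<nu> = (\<kappa> + 2 + y) / (\<kappa> + 1)"
  define r where "r = y / \<kappa>"
  define B where "B = (\<kappa>\<^sup>2 - \<kappa> + y\<^sup>2 + y) / (\<kappa> * y)"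
  define F where "F = (\<kappa> - y) / \<kappa>\<^sup>2"
  define G where "G i = (- 1) ^ i * (u i - u (i + 1)) / \<nu>" for i
  have \<kappa>0: "0 < \<kappa>" "0 < \<kappa> - y" using \<kappa> y by auto
  have \<nu>: "\<nu> * (\<kappa> + 1) = \<kappa> + 2 + y" "0 < \<nu>" using \<kappa>0 y by (auto simp: \<nu>_def)
  have r: "r * \<kappa> = y" "0 < r" "r < 1" using \<kappa>0 y by (auto simp: r_def)
  have B: "B * (\<kappa> * y) = \<kappa>\<^sup>2 - \<kappa> + y\<^sup>2 + y" using \<kappa>0 y by (auto simp: B_def)
  have F: "F * \<kappa>\<^sup>2 = \<kappa> - y" "0 < F" using \<kappa>0 by (auto simp: F_def)
  have Br: "B * r * \<kappa>\<^sup>2 = \<kappa>\<^sup>2 - \<kappa> + y\<^sup>2 + y"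
    using B unfolding r(1)[symmetric] by (simp add: power2_eq_square mult_ac)
  have F_eq: "1 - B * r + r\<^sup>2 = F"
  proof -
    have "(1 - B * r + r\<^sup>2) * \<kappa>\<^sup>2 = \<kappa>\<^sup>2 - B * r * \<kappa>\<^sup>2 + (r * \<kappa>)\<^sup>2"
      by (simp add: algebra_simps power2_eq_square)
    also have "\<dots> = F * \<kappa>\<^sup>2" unfolding Br r(1) F(1) by simp
    finally show ?thesis using \<kappa>0 by simp
  qed
  have nz1: "(\<kappa> + 1) * \<kappa> \<noteq> 0" and nz2: "(\<kappa> + 1) * \<kappa>\<^sup>2 \<noteq> 0" using \<kappa>0 by auto
  have d0: "u 0 - u 1 = \<nu>"
  proof -
    have "(u 0 - u 1) * (\<kappa> + 1) = \<nu> * (\<kappa> + 1)" using u1 unfolding u0 \<nu>(1) by (simp add: algebra_simps)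
    then show ?thesis using \<kappa>0 by simp
  qed
  have d1: "u 1 - u 2 = - (\<nu> * r)"
  proof -
    have "(u 1 - u 2) * ((\<kappa> + 1) * \<kappa>) = (\<kappa> + 2 + y) * (- y)"
      using cosine_values(3)[OF u1 u2 u3] by (simp add: algebra_simps)
    also have "\<dots> = (\<nu> * (\<kappa> + 1)) * - (r * \<kappa>)" unfolding \<nu>(1) r(1) ..
    also have "\<dots> = - (\<nu> * r) * ((\<kappa> + 1) * \<kappa>)" by simp
    finally show ?thesis unfolding mult_right_cancel[OF nz1] .
  qed
  have d2: "u 2 - u 3 = \<nu> * (B * r - 1)"
  proof -
    have "(u 2 - u 3) * ((\<kappa> + 1) * \<kappa>\<^sup>2) = (\<kappa> + 2 + y) * ((\<kappa>\<^sup>2 - \<kappa> + y\<^sup>2 + y) - \<kappa>\<^sup>2)"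
      using cosine_values(4)[OF u1 u2 u3] by (simp add: algebra_simps power2_eq_square)
    also have "\<dots> = (\<nu> * (\<kappa> + 1)) * (B * r * \<kappa>\<^sup>2 - \<kappa>\<^sup>2)" unfolding \<nu>(1) Br ..
    also have "\<dots> = \<nu> * (B * r - 1) * ((\<kappa> + 1) * \<kappa>\<^sup>2)" by (simp add: algebra_simps)
    finally show ?thesis unfolding mult_right_cancel[OF nz2] .
  qed
  have d_rec: "u (i + 2) - u (i + 3) = - B * (u (i + 1) - u (i + 2)) - (u i - u (i + 1))" if "i + 3 \<le> D" for i
  proof -
    have u03: "u 0 - u 3 = \<nu> * r * (B - 1)" using d0 d1 d2 by (simp add: algebra_simps)
    have "(u (i + 1) - u (i + 2)) * (\<nu> * r * (B - 1)) = - (\<nu> * r) * (u i - u (i + 3))"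
      using rec[OF that] unfolding u03 d1 .
    then have "\<nu> * r * ((u (i + 1) - u (i + 2)) * (B - 1)) = \<nu> * r * (u (i + 3) - u i)"
      by (simp add: algebra_simps)
    then have "(u (i + 1) - u (i + 2)) * (B - 1) = u (i + 3) - u i" using \<nu> r by simp
    then show ?thesis by (simp add: algebra_simps)
  qed
  have G0: "G 0 = 1" using d0 \<nu> by (simp add: G_def)
  have G1: "G 1 = r" using d1 \<nu> by (simp add: G_def numeral_2_eq_2)
  have G_rec: "G (i + 2) = B * G (i + 1) - G i" if "i + 3 \<le> D" for i
  proof -
    have "G (i + 2) = (- 1) ^ i * (u (i + 2) - u (i + 3)) / \<nu>" by (simp add: G_def numeral_3_eq_3)
    then show ?thesis
      unfolding d_rec[OF that] by (simp add: G_def diff_divide_distrib add_divide_distrib algebra_simps)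
  qed
  have G_inv: "(G i)\<^sup>2 - B * G i * G (i + 1) + (G (i + 1))\<^sup>2 = F" if "i + 2 \<le> D" for i
    using that
  proof (induction i)
    case 0
    then show ?case using G0 G1 F_eq by simp
  next
    case (Suc i)
    have G2: "G (Suc i + 1) = B * G (i + 1) - G i" using G_rec[of i] Suc.prems by simp
    show ?case using Suc unfolding G2 by (simp add: algebra_simps power2_eq_square)
  qed
  \<comment> \<open>The bound \<theta> \<ge> 1 - k, that is y \<le> \<kappa> - 1, is exactly what
    makes B \<ge> 2.\<close>
  have B2: "(B - 2) * (\<kappa> * y) = (\<kappa> - y) * (\<kappa> - 1 - y)"
    using B by (simp add: algebra_simps power2_eq_square)
  then have "0 \<le> (B - 2) * (\<kappa> * y)" using \<kappa>0 y by simp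
  moreover have \<kappa>y: "0 < \<kappa> * y" using \<kappa>0 y by simp
  ultimately have B_ge: "2 \<le> B" using zero_le_mult_iff[of "B - 2" "\<kappa> * y"] by linarith
  have G_decr: "G (i + 1) < G i" if "i + 2 \<le> D" for i
    using that
  proof (induction i)
    case 0
    then show ?case using G0 G1 r by simp
  next
    case (Suc i)
    have G2: "G (Suc i + 1) = B * G (i + 1) - G i" using G_rec[of i] Suc.prems by simp
    \<comment> \<open>Consecutive decrements have a positive product, so their sign is inherited
      from \<open>G 0 > G 1\<close>.\<close>
    have "(G i - G (i + 1)) * (G (i + 1) - G (Suc i + 1)) = (B - 2) * (G (i + 1))\<^sup>2 + F"
      using G_inv[of i] Suc.prems unfolding G2 by (simp add: algebra_simps power2_eq_square)
    also have "\<dots> > 0" using B_ge F by (simp add: add_nonneg_pos)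
    finally show ?case using Suc by (simp add: zero_less_mult_iff)
  qed
  define g g' where "g = G (D - 1)" and "g' = G (D - 2)"
  define s :: real where "s = (- 1) ^ D"
  obtain N where N: "D = Suc (Suc N)" using D by (cases D; cases "D - 1") auto
  have s_cases: "s = 1 \<or> s = - 1" unfolding s_def by (cases "even D") auto
  then have ss: "s * s = 1" by auto
  have sG: "(- 1) ^ (D - 2) = s" "(- 1) ^ (D - 1) = - s"
    by (simp_all add: s_def N)
  have dg: "u (D - 1) - u D = - (\<nu> * (s * g))" "u (D - 2) - u (D - 1) = \<nu> * (s * g')"
  proof -
    have "D - 1 + 1 = D" "D - 2 + 1 = D - 1" using D by auto
    then have "g = - s * (u (D - 1) - u D) / \<nu>" "g' = s * (u (D - 2) - u (D - 1)) / \<nu>"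
      unfolding g_def g'_def G_def sG by simp_all
    then have "\<nu> * g = - s * (u (D - 1) - u D)" "\<nu> * g' = s * (u (D - 2) - u (D - 1))"
      using \<nu>(2) by simp_all
    then have "s * (\<nu> * g) = - ((s * s) * (u (D - 1) - u D))" "s * (\<nu> * g') = (s * s) * (u (D - 2) - u (D - 1))"
      by simp_all
    then show "u (D - 1) - u D = - (\<nu> * (s * g))" "u (D - 2) - u (D - 1) = \<nu> * (s * g')"
      unfolding ss by (simp_all add: mult_ac)
  qed
  have H: "u D = s * g"
  proof -
    have "(\<kappa> + 1) * (u (D - 1) - u D) = - (\<nu> * (\<kappa> + 1)) * u D"
      using uD(1) unfolding \<nu>(1) by (simp add: algebra_simps)
    then have "(\<kappa> + 1) * (\<nu> * (s * g)) = (\<kappa> + 1) * (\<nu> * u D)" unfolding dg by simp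
    then show ?thesis using \<kappa>0 \<nu>(2) by simp
  qed
  have H1: "s * g < 1" using uD(2) H by simp
  have uD_vals: "u (D - 1) = s * g * (1 - \<nu>)" "u (D - 2) = s * g * (1 - \<nu>) + \<nu> * (s * g')"
    using dg H by (simp_all add: algebra_simps)
  have b_eq: "b * (g' - g) = (\<kappa> + 1) * g' - (1 + y) * g"
  proof -
    have "(\<kappa> + 1 - b) * (s * g * (1 - \<nu>) + \<nu> * (s * g')) + b * (s * g) = - (1 + y) * (s * g * (1 - \<nu>))"
      using uD1 unfolding uD_vals H .
    then have "\<nu> * s * (b * (g' - g) - ((\<kappa> + 1) * g' - (1 + y) * g)) = 0"
      using \<nu>(1) by algebra
    then show ?thesis using \<nu>(2) ss by auto
  qed
  \<comment> \<open>Summing the recurrence shows that u i + B u (i + 1) + u (i + 2) is constant;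
    this equates its values at the two ends.\<close>
  have T: "(2 + B) * (1 - s * g) = \<nu> * ((1 + B) * (1 - s * g) - r + s * g')"
  proof -
    have "u i + u (i + 2) + B * u (i + 1) = u 0 + u 2 + B * u 1" if "i + 2 \<le> D" for i
      using that
    proof (induction i)
      case (Suc i)
      then show ?case using d_rec[of i] by (simp add: algebra_simps numeral_3_eq_3 numeral_2_eq_2)
    qed (simp add: numeral_2_eq_2)
    from this[of "D - 2"] have "u (D - 2) + u D + B * u (D - 1) = u 0 + u 2 + B * u 1"
      by (simp add: N)
    moreover have u12: "u 1 = 1 - \<nu>" "u 2 = 1 - \<nu> + \<nu> * r" using d0 d1 u0 by (simp_all add: algebra_simps)
    ultimately show ?thesis unfolding uD_vals H u0 u12 by (simp add: algebra_simps)
  qed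
  \<comment> \<open>\<open>L\<close> collects the terms of \<open>T\<close> proportional to 1 - s g.
    Its negativity gives s (g' - r g) < 0, whereas b \<ge> 1 will give g' \<ge> r g; hence s =
    -1.\<close>
  define L where "L = 2 + B - \<nu> * (1 + B - r)"
  have L: "L * (\<kappa> * y * (\<kappa> + 1)) = - ((\<kappa> - 1) * (\<kappa> - y))"
  proof -
    have "L * (\<kappa> * y * (\<kappa> + 1)) = (2 * (\<kappa> * y) + B * (\<kappa> * y)) * (\<kappa> + 1)
        - (\<nu> * (\<kappa> + 1)) * (\<kappa> * y + B * (\<kappa> * y) - (r * \<kappa>) * y)"
      unfolding L_def by (simp add: algebra_simps)
    then show ?thesis unfolding \<nu>(1) B r(1) by (simp add: algebra_simps power2_eq_square)
  qed
  have L0: "L < 0"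
  proof -
    have "L * (\<kappa> * y * (\<kappa> + 1)) < 0" unfolding L using \<kappa> \<kappa>0 by simp
    moreover have "0 < \<kappa> * y * (\<kappa> + 1)" using \<kappa>y \<kappa>0 by simp
    ultimately show ?thesis using mult_less_0_iff[of L "\<kappa> * y * (\<kappa> + 1)"] by linarith
  qed
  have LT: "\<nu> * (s * (g' - r * g)) = L * (1 - s * g)"
    using T unfolding L_def by (simp add: algebra_simps)
  then have neg: "s * (g' - r * g) < 0"
  proof -
    have "\<nu> * (s * (g' - r * g)) < 0" unfolding LT using L0 H1 by (intro mult_neg_pos) auto
    then show ?thesis using \<nu>(2) mult_less_0_iff[of \<nu> "s * (g' - r * g)"] by linarith
  qed
  have e_pos: "g < g'"
    using G_decr[of "D - 2"] N unfolding g_def g'_def by simp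
  have b1: "(b - 1) * (g' - g) = \<kappa> * (g' - r * g)"
    using b_eq r(1) by algebra
  then have "0 \<le> \<kappa> * (g' - r * g)" using b(1) e_pos mult_nonneg_nonneg[of "b - 1" "g' - g"] by simp
  then have "0 \<le> g' - r * g" using \<kappa>0 zero_le_mult_iff[of \<kappa> "g' - r * g"] by linarith
  then have s: "s = - 1" and "0 < g' - r * g" using neg s_cases by auto
  then have "0 < (b - 1) * (g' - g)" unfolding b1 using \<kappa>0 by simp
  then have "1 < b" using e_pos zero_less_mult_iff[of "b - 1" "g' - g"] by linarith
  then have b2: "2 \<le> b" "\<kappa> \<le> b * (b - 1)" using b(2) by auto
  have "odd D" using s unfolding s_def by (cases "even D") auto
  then have D7: "7 \<le> D" using D by presburger
  \<comment> \<open>For B = 2 the characteristic root is 1 and the closed form below breaks down. In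
    this case \<theta> = 1 - k, and the end conditions contradict each other directly.\<close>
  have B_gt: "2 < B"
  proof (rule ccontr)
    assume "\<not> 2 < B"
    then have "B = 2" using B_ge by simp
    then have y\<kappa>: "y = \<kappa> - 1" using B2 \<kappa>0 by simp
    have rr: "1 - r = 1 / \<kappa>" using r(1) \<kappa>0 unfolding y\<kappa> by (simp add: field_simps)
    have "(g' - g)\<^sup>2 = F"
      using G_inv[of "D - 2"] N \<open>B = 2\<close> unfolding g_def g'_def
      by (simp add: power2_diff)
    also have "F = (1 / \<kappa>)\<^sup>2" unfolding F_def y\<kappa> by (simp add: power_divide)
    finally have e: "g' - g = 1 / \<kappa>" using e_pos \<kappa>0 by (simp add: power2_eq_iff_nonneg)
    have "g' - r * g = (g' - g) + (1 - r) * g" by (simp add: algebra_simps)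
    then have "g' - r * g = (1 + g) / \<kappa>" unfolding e rr by (simp add: add_divide_distrib)
    then have "\<kappa> * (g' - r * g) = 1 + g" using \<kappa>0 by simp
    moreover have "- (\<nu> * (g' - r * g)) = L * (1 + g)" using LT unfolding s by algebra
    ultimately have "(1 + g) * (L * \<kappa> + \<nu>) = 0" by algebra
    then have "L * \<kappa> = - \<nu>" using H1 s by simp
    then have "- \<nu> * (\<kappa> + 1) * y = - ((\<kappa> - 1) * (\<kappa> - y))" using L by algebra
    then have "(\<kappa> + 2 + y) * y = (\<kappa> - 1) * (\<kappa> - y)" using \<nu>(1) by algebra
    then have "(\<kappa> - 1) * \<kappa> = 0" unfolding y\<kappa> by algebra
    then show False using \<kappa> by simp
  qed
  define S where "S = sqrt (B\<^sup>2 - 4)"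
  have "4 < B\<^sup>2" using B_gt power_strict_mono[of 2 B 2] by simp
  then have S: "S\<^sup>2 = B\<^sup>2 - 4" "0 \<le> S" by (auto simp: S_def)
  define p where "p = (B + S) / 2"
  have p1: "1 < p" using B_gt S(2) by (simp add: p_def)
  have pB: "p\<^sup>2 + 1 = B * p"
    using S(1) unfolding p_def by (simp add: field_simps power2_eq_square)
  have pr: "0 < p - r" using p1 r by simp
  have Fp: "(p - r) * (1 - r * p) = F * p"
    using pB unfolding F_eq[symmetric] by algebra
  have "0 < (p - r) * (1 - r * p)" unfolding Fp using F p1 by simp
  then have rp: "0 < 1 - r * p" using pr zero_less_mult_iff[of "p - r" "1 - r * p"] by linarith
  \<comment> \<open>With p the larger root of X^2 - B X + 1, \<omega> is chosen so that (p^(-i) -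
    \<omega> p^i) / (1 - \<omega>) equals 1 and r at i = 0 and i = 1.\<close>
  define \<omega> where "\<omega> = (1 - r * p) / (p * (p - r))"
  have \<omega>: "\<omega> * (p * (p - r)) = 1 - r * p" "0 < \<omega>"
    using p1 pr rp by (auto simp: \<omega>_def)
  have \<omega>': "(1 - \<omega>) * (p * (p - r)) = p\<^sup>2 - 1"
    unfolding left_diff_distrib \<omega>(1) by (simp add: algebra_simps power2_eq_square)
  have rp\<omega>: "r * p * (1 - \<omega>) = 1 - \<omega> * p\<^sup>2"
    using \<omega>(1) by (simp add: algebra_simps power2_eq_square)
  have "0 < (1 - \<omega>) * (p * (p - r))" unfolding \<omega>' using p1 by simp
  moreover have "0 < p * (p - r)" using p1 pr by simp
  ultimately have \<omega>1: "0 < 1 - \<omega>" using zero_less_mult_iff[of "1 - \<omega>" "p * (p - r)"] by linarith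
  have G_closed: "G i * (1 - \<omega>) * p ^ i = 1 - \<omega> * p ^ (2 * i)" if "i + 1 \<le> D" for i
    using that
  proof (induction i rule: less_induct)
    case (less i)
    consider "i = 0" | "i = 1" | j where "i = j + 2" by (metis One_nat_def add_2_eq_Suc' not0_implies_Suc)
    then show ?case
    proof cases
      case 3
      have "G i * (1 - \<omega>) * p ^ i = B * p * (G (j + 1) * (1 - \<omega>) * p ^ (j + 1)) - p\<^sup>2 * (G j * (1 - \<omega>) * p ^ j)"
      proof -
        have G2: "G i = B * G (j + 1) - G j" using G_rec[of j] less.prems unfolding 3 by simp
        show ?thesis unfolding G2 by (simp add: 3 algebra_simps power2_eq_square)
      qed
      also have "\<dots> = (p\<^sup>2 + 1) * (1 - \<omega> * p ^ (2 * (j + 1))) - p\<^sup>2 * (1 - \<omega> * p ^ (2 * j))"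
        using less.IH[of "j + 1"] less.IH[of j] less.prems unfolding 3 pB by simp
      also have "\<dots> = 1 - \<omega> * p ^ (2 * i)"
        unfolding 3 by (simp add: algebra_simps power2_eq_square)
      finally show ?thesis .
    qed (use G0 G1 rp\<omega> in \<open>simp_all add: mult_ac\<close>)
  qed
  define P where "P = p ^ D"
  have P7: "p ^ 7 \<le> P" unfolding P_def using D7 p1 by (intro power_increasing) auto
  have P0: "0 < P" using p1 by (simp add: P_def)
  have P_split: "P = p * p ^ (D - 1)" "P = p\<^sup>2 * p ^ (D - 2)"
    by (simp_all add: P_def N power2_eq_square)
  have gP: "g * (1 - \<omega>) * P * p = p\<^sup>2 - \<omega> * P\<^sup>2"
  proof -
    have "g * (1 - \<omega>) * p ^ (D - 1) = 1 - \<omega> * (p ^ (D - 1))\<^sup>2"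
      unfolding g_def power_even_eq[symmetric] using D by (intro G_closed) simp
    moreover define X where "X = p ^ (D - 1)"
    ultimately have "g * (1 - \<omega>) * X = 1 - \<omega> * X\<^sup>2" by simp
    then show ?thesis unfolding P_split(1) X_def[symmetric] by algebra
  qed
  have g'P: "g' * (1 - \<omega>) * P * p\<^sup>2 = p ^ 4 - \<omega> * P\<^sup>2"
  proof -
    have "g' * (1 - \<omega>) * p ^ (D - 2) = 1 - \<omega> * (p ^ (D - 2))\<^sup>2"
      unfolding g'_def power_even_eq[symmetric] using D by (intro G_closed) simp
    moreover define X where "X = p ^ (D - 2)"
    ultimately have "g' * (1 - \<omega>) * X = 1 - \<omega> * X\<^sup>2" by simp
    then show ?thesis unfolding P_split(2) X_def[symmetric] by algebra
  qed
  have gP1: "(1 + g) * (1 - \<omega>) * P * p = (P + p) * (p - \<omega> * P)"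
    using gP by (simp add: algebra_simps power2_eq_square)
  have small: "\<omega> * P < p"
  proof -
    have "0 < (1 + g) * (1 - \<omega>) * P * p"
      using H1 s \<omega>1 P0 p1 by simp
    then have "0 < (P + p) * (p - \<omega> * P)" unfolding gP1 .
    then show ?thesis using P0 p1 zero_less_mult_iff[of "P + p" "p - \<omega> * P"] by linarith
  qed
  \<comment> \<open>Rests on F \<kappa> = 1 - r, a relation between the initial data of the
    recurrence.\<close>
  have A: "\<kappa> * \<omega> * (p - 1) * (p + 1)\<^sup>2 = p * (1 - \<omega>) * (1 + \<omega> * p)"
  proof -
    have "F * \<kappa> = 1 - r"
    proof -
      have "F * \<kappa> * \<kappa> = (1 - r) * \<kappa>" using F(1) r(1) by (simp add: power2_eq_square algebra_simps)
      then show ?thesis using \<kappa>0 by simp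
    qed
    then have "\<kappa> * \<omega> * (p - r)\<^sup>2 = 1 - r"
    proof -
      have "p * F = p * (\<omega> * (p - r)\<^sup>2)" using Fp \<omega>(1) by algebra
      then have "F = \<omega> * (p - r)\<^sup>2" using p1 by simp
      then show ?thesis using \<open>F * \<kappa> = 1 - r\<close> by (simp add: mult_ac)
    qed
    moreover have "(1 - r) * p * (1 - \<omega>) = (p - 1) * (1 + \<omega> * p)" using rp\<omega> by algebra
    ultimately have "\<kappa> * \<omega> * ((1 - \<omega>) * (p * (p - r)))\<^sup>2 = p * (1 - \<omega>) * ((p - 1) * (1 + \<omega> * p))"
      by algebra
    then have "(p - 1) * (\<kappa> * \<omega> * (p - 1) * (p + 1)\<^sup>2) = (p - 1) * (p * (1 - \<omega>) * (1 + \<omega> * p))"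
      unfolding \<omega>' by algebra
    then show ?thesis using p1 by simp
  qed
  have \<nu>P: "\<nu> * p * (1 + P) = (1 + p) * (P + p)"
  proof -
    have Bp: "(2 + B) * p = (p + 1)\<^sup>2" "(1 + B) * p = p\<^sup>2 + p + 1"
      using pB by (simp_all add: algebra_simps power2_eq_square)
    have "((1 + B) * (1 + g) - r - g') * ((1 - \<omega>) * P * p\<^sup>2)
        = ((1 + B) * p) * ((1 + g) * (1 - \<omega>) * P * p) - (r * p * (1 - \<omega>)) * P * p - g' * (1 - \<omega>) * P * p\<^sup>2"
      by (simp add: algebra_simps power2_eq_square)
    also have "\<dots> = (1 + p) * (p - \<omega> * P) * (p * (1 + P))"
      unfolding Bp gP1 rp\<omega> g'P by algebra
    finally have rhs: "((1 + B) * (1 + g) - r - g') * ((1 - \<omega>) * P * p\<^sup>2)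
        = (1 + p) * (p - \<omega> * P) * (p * (1 + P))" .
    have "(2 + B) * (1 + g) = \<nu> * ((1 + B) * (1 + g) - r - g')" using T s by simp
    then have "((2 + B) * p) * ((1 + g) * (1 - \<omega>) * P * p)
        = \<nu> * (((1 + B) * (1 + g) - r - g') * ((1 - \<omega>) * P * p\<^sup>2))" by algebra
    then have "(1 + p) * (p - \<omega> * P) * (\<nu> * p * (1 + P)) = (1 + p) * (p - \<omega> * P) * ((1 + p) * (P + p))"
      unfolding rhs Bp gP1 by algebra
    then show ?thesis using small p1 by simp
  qed
  have yP: "(1 + y) * p * (1 + P) = (\<kappa> + 1) * (P + p\<^sup>2)"
  proof -
    have "(1 + y) * p * (1 + P) = \<nu> * p * (1 + P) * (\<kappa> + 1) - (\<kappa> + 1) * p * (1 + P)"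
      using \<nu>(1) by algebra
    then show ?thesis unfolding \<nu>P by (simp add: algebra_simps power2_eq_square)
  qed
  \<comment> \<open>Eliminate y between \<open>yP\<close>, which carries the condition at distance
    D, and \<open>rp\<omega>\<close>, which carries \<open>G 1 = r\<close>.\<close>
  have Bk: "\<kappa> * (p + 1) * (1 + \<omega> * P) = (P - p) * (1 - \<omega>)"
  proof -
    have "y * p * (1 - \<omega>) = \<kappa> * (1 - \<omega> * p\<^sup>2)" using rp\<omega> r(1) by algebra
    then have "(p - 1) * (\<kappa> * (p + 1) * (1 + \<omega> * P)) = (p - 1) * ((P - p) * (1 - \<omega>))"
      using yP by algebra
    then show ?thesis using p1 by simp
  qed
  have bP: "b * (1 + \<omega> * P) * (p ^ 3 + \<omega> * P\<^sup>2) = (1 + \<omega> * p) * (p\<^sup>2 + \<omega> * P) * P"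
  proof -
    have e1: "(g' - g) * (1 - \<omega>) * P * p\<^sup>2 = (p - 1) * (p ^ 3 + \<omega> * P\<^sup>2)"
      using gP g'P by algebra
    have "(b * (g' - g)) * (p * (1 + P)) * (1 - \<omega>) * P * p\<^sup>2
        = ((\<kappa> + 1) * g' * (p * (1 + P)) - ((1 + y) * p * (1 + P)) * g) * (1 - \<omega>) * P * p\<^sup>2"
      unfolding b_eq by (simp add: algebra_simps)
    also have "\<dots> = (\<kappa> + 1) * p * ((1 + P) * (g' * (1 - \<omega>) * P * p\<^sup>2) - (P + p\<^sup>2) * (g * (1 - \<omega>) * P * p))"
      unfolding yP by (simp add: algebra_simps power2_eq_square)
    also have "\<dots> = (p - 1) * (p * ((\<kappa> + 1) * P * (p + 1) * (p\<^sup>2 + \<omega> * P)))"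
      unfolding gP g'P by algebra
    finally have "(p - 1) * (p * (b * (p ^ 3 + \<omega> * P\<^sup>2) * (1 + P)))
        = (p - 1) * (p * ((\<kappa> + 1) * P * (p + 1) * (p\<^sup>2 + \<omega> * P)))"
      using e1 by algebra
    then have "b * (p ^ 3 + \<omega> * P\<^sup>2) * (1 + P) = (\<kappa> + 1) * P * (p + 1) * (p\<^sup>2 + \<omega> * P)"
      using p1 by simp
    moreover have "(\<kappa> + 1) * (p + 1) * (1 + \<omega> * P) = (1 + P) * (1 + \<omega> * p)"
      using Bk by algebra
    ultimately have "(1 + P) * (b * (1 + \<omega> * P) * (p ^ 3 + \<omega> * P\<^sup>2)) = (1 + P) * ((1 + \<omega> * p) * (p\<^sup>2 + \<omega> * P) * P)"
      by algebra
    then show ?thesis using P0 by simp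
  qed
  have "b\<^sup>2 \<le> \<kappa> + 1"
    using end_valency_square_le[OF p1 P7 \<omega>(2) small A Bk bP] .
  \<comment> \<open>The two bounds give b^2 \<le> b^2 - b + 1, against b \<ge> 2.\<close>
  then show False using b2 by (simp add: power2_eq_square algebra_simps)
qed

section \<open>The theorem\<close>

context bipartite_qdrg
begin

text \<open>Complements of two blocks meet in m = k - 2c + n points, and b (b - 1) = (k - 1) m.
  Since b \<ge> 2 makes the left side positive, m is at least 1. Integers are used because k - 2c
  may be negative.\<close>

lemma end_valency_bound:
  assumes "c 2 = 1" "4 \<le> D" "2 \<le> b (D - 1)" "3 \<le> k"
  shows "k - 1 \<le> b (D - 1) * (b (D - 1) - 1)"
proof -
  obtain n where n: "(k - 1) * n = c (D - 1) * (c (D - 1) - 1)"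
    using opposite_neighbourhoods_design assms by blast
  have cb: "c (D - 1) + b (D - 1) = k" "1 \<le> c (D - 1)" using c_plus_b c_pos assms by auto
  define \<gamma> \<beta> K m where "\<gamma> = int (c (D - 1))" and "\<beta> = int (b (D - 1))" and "K = int k" and "m = K - 2 * \<gamma> + int n"
  have "int ((k - 1) * n) = int (c (D - 1) * (c (D - 1) - 1))" using n by simp
  then have nn: "(K - 1) * int n = \<gamma> * (\<gamma> - 1)"
    using cb assms(4) by (simp add: \<gamma>_def K_def of_nat_diff)
  have K: "K = \<gamma> + \<beta>" using cb by (simp add: \<gamma>_def \<beta>_def K_def)
  have eq: "\<beta> * (\<beta> - 1) = (K - 1) * m" using nn unfolding m_def K by algebra
  have "0 < \<beta> * (\<beta> - 1)" using assms(3) by (simp add: \<beta>_def)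
  moreover have K1: "0 < K - 1" using assms(4) by (simp add: K_def)
  ultimately have "0 < m" unfolding eq using zero_less_mult_iff[of "K - 1" m] by linarith
  then have "(K - 1) * 1 \<le> \<beta> * (\<beta> - 1)" unfolding eq using K1 by (intro mult_left_mono) auto
  then have "int (k - 1) \<le> int (b (D - 1) * (b (D - 1) - 1))"
    using assms(3,4) by (simp add: \<beta>_def K_def of_nat_diff)
  then show ?thesis by linarith
qed

lemma c_2_ge_2:
  assumes D: "6 \<le> D" and k: "3 \<le> k"
  shows "2 \<le> c 2"
proof (rule ccontr)
  assume "\<not> 2 \<le> c 2"
  then have c2: "c 2 = 1" using c_pos[of 2] D by simp
  obtain \<theta> where \<theta>: "\<And>x y. (\<Sum>z | G x z. u (d z y)) = \<theta> * u (d x y)" using u_eigenvector by blast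
  define v where "v i = u i / u 0" for i
  have v0: "v 0 = 1" using u_0_pos by (simp add: v_def)
  have v_distinct: "v i \<noteq> v j" if "i \<le> D" "j \<le> D" "i \<noteq> j" for i j
    using u_distinct[of i j] that u_0_pos by (auto simp: v_def)
  have v_bound: "\<bar>v i\<bar> \<le> 1" if "i \<le> D" for i
    using abs_u_le[OF that] u_0_pos by (simp add: v_def divide_le_eq)
  have step: "real (c i) * v (i - 1) + (real k - real (c i)) * v (i + 1) = \<theta> * v i"
    if "0 < i" "i \<le> D" for i
  proof -
    have "real (b i) = real k - real (c i)" using c_plus_b[OF that] by simp
    then have "(real (c i) * u (i - 1) + (real k - real (c i)) * u (i + 1)) / u 0 = \<theta> * u i / u 0"
      using u_three_term[OF \<theta> that] by simp
    then show ?thesis by (simp add: v_def add_divide_distrib)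
  qed
  have e0: "real k * v 1 = \<theta>"
    using u_first_term[OF \<theta>] u_0_pos by (simp add: v_def field_simps)
  have e1: "1 + (real k - 1) * v 2 = \<theta> * v 1"
    using step[of 1] c_1 D v0 by (simp add: numeral_2_eq_2)
  have e2: "v 1 + (real k - 1) * v 3 = \<theta> * v 2"
    using step[of 2] c2 D by (simp add: numeral_3_eq_3)
  have e3: "real (c 3) * v 2 + (real k - real (c 3)) * v 4 = \<theta> * v 3"
    using step[of 3] D by simp
  have rec: "(v (m + 1) - v (m + 2)) * (v 0 - v 3) = (v 1 - v 2) * (v m - v (m + 3))" if "m + 3 \<le> D" for m
    using u_recurrence[OF that] by (simp only: v_def diff_divide_distrib[symmetric] times_divide_times_eq)
  define \<kappa> where "\<kappa> = real k - 1"
  have \<kappa>: "2 \<le> \<kappa>" "real k = \<kappa> + 1" using k by (auto simp: \<kappa>_def)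
  have v1: "v 1 = \<theta> / real k" using e0 k by (simp add: field_simps)
  have \<theta>_le: "\<bar>\<theta>\<bar> \<le> real k"
    using v_bound[of 1] D k unfolding v1 by (simp add: divide_le_eq)
  have "\<theta> \<noteq> real k"
    using v_distinct[of 1 0] D v0 k unfolding v1 by auto
  \<comment> \<open>The value -k belongs to the bipartition, for which \<open>v\<close> takes the
    value 1 again at distance 2.\<close>
  moreover have "\<theta> \<noteq> - real k"
  proof
    assume "\<theta> = - real k"
    then have "(real k - 1) * (v 2 - 1) = 0" using e1 k unfolding v1 by (simp add: algebra_simps)
    then show False using v_distinct[of 2 0] D v0 k by simp
  qed
  ultimately have \<theta>_less: "\<bar>\<theta>\<bar> < real k" using \<theta>_le by linarith
  have "\<theta> \<noteq> - 1"
  proof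
    assume "\<theta> = - 1"
    then have "(v 1 - v 2) * ((\<kappa> + 1) * \<kappa>) = 0"
      using cosine_values(3)[of \<kappa> "v 1" \<theta> "v 2" "v 3"] e0 e1 e2 by (simp add: \<kappa>_def)
    then show False using v_distinct[of 1 2] D \<kappa> by simp
  qed
  have "(real (c 3) - 1) * ((real k - 1) * (\<theta> + real k - 1) - (\<theta> + 1) * \<theta>\<^sup>2)
      = (real k - 1)\<^sup>2 * (real k - 2)"
  proof (rule third_intersection_number[OF _ \<theta>_less \<open>\<theta> \<noteq> - 1\<close> e0 e1 e2 e3])
    show "2 < real k" using k by simp
    show "(v 2 - v 3) * (1 - v 3) = (v 1 - v 2) * (v 1 - v 4)"
      using rec[of 1] D v0 by (simp add: eval_nat_numeral)
  qed
  moreover have "2 * real (c 3) \<le> real k"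
    using c_le_b[of 3 3] c_plus_b[of 3] D by simp
  moreover have "1 \<le> c 3" using c_pos[of 3] D by simp
  ultimately have range: "1 - real k \<le> \<theta>" "\<theta> < - 1"
    using eigenvalue_range[of "real k" \<theta> "c 3"] \<theta>_less \<open>\<theta> \<noteq> - 1\<close> k by auto
  define y where "y = - 1 - \<theta>"
  have y: "- (1 + y) = \<theta>" by (simp add: y_def)
  have bc: "real (c (D - 1)) = \<kappa> + 1 - real (b (D - 1))" using c_plus_b[of "D - 1"] D by (simp add: \<kappa>_def)
  show False
  proof (rule negative_eigenvalue_contradiction[of \<kappa> y D v "real (b (D - 1))"])
    show "2 \<le> \<kappa>" "6 \<le> D" "v 0 = 1" by (fact \<kappa> D v0)+
    show "0 < y" "y \<le> \<kappa> - 1" using range by (auto simp: y_def \<kappa>_def)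
    show "(\<kappa> + 1) * v 1 = - (1 + y)" "1 + \<kappa> * v 2 = - (1 + y) * v 1" "v 1 + \<kappa> * v 3 = - (1 + y) * v 2"
      using e0 e1 e2 unfolding y by (simp_all add: \<kappa>_def)
    show "(v (m + 1) - v (m + 2)) * (v 0 - v 3) = (v 1 - v 2) * (v m - v (m + 3))" if "m + 3 \<le> D" for m
      using rec[OF that] .
    show "(\<kappa> + 1 - real (b (D - 1))) * v (D - 2) + real (b (D - 1)) * v D = - (1 + y) * v (D - 1)"
      using step[of "D - 1"] D bc unfolding y by (simp add: \<kappa>_def numeral_2_eq_2)
    show "(\<kappa> + 1) * v (D - 1) = - (1 + y) * v D"
      using step[of D] c_plus_b[of D] b_diam D unfolding y by (simp add: \<kappa>_def)
    show "v D < 1" using v_bound[of D] v_distinct[of D 0] v0 D by (simp add: abs_le_iff)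
    show "1 \<le> real (b (D - 1))" using b_pos[of "D - 1"] D by simp
    show "2 \<le> real (b (D - 1)) \<and> \<kappa> \<le> real (b (D - 1)) * (real (b (D - 1)) - 1)"
      if "1 < real (b (D - 1))"
    proof -
      have b2: "2 \<le> b (D - 1)" using that by simp
      have "real (k - 1) \<le> real (b (D - 1) * (b (D - 1) - 1))"
        using end_valency_bound[OF c2 _ b2 k] D by (intro of_nat_mono) simp
      then show ?thesis using b2 k by (simp add: \<kappa>_def of_nat_diff)
    qed
  qed
qed

end

section \<open>The intersection number \<open>c_number\<close> and the girth\<close>

context bipartite_drg
begin

lemma c_number_eq: "c_number G i = c i" if "i \<le> D"
proof -
  obtain x y where xy: "d x y = i" using pair_at_distance \<open>i \<le> D\<close> by blast
  have "(THE n. \<forall>x y. d x y = i \<longrightarrow> card (gsphere G 1 x \<inter> gsphere G (i - 1) y) = n) = p i 1 (i - 1)"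
    using xy sphere_inter by (intro the_equality) auto
  then show ?thesis by (simp add: c_number_def intersection_number_def c_def)
qed

text \<open>Two common neighbours of vertices at distance 2 close a 4-cycle. A triangle would
  contain an edge whose ends are equally far from the third vertex, against bipartiteness.\<close>

lemma girth_eq_4:
  assumes "2 \<le> c 2" "2 \<le> D"
  shows "girth G = 4"
proof (rule antisym)
  obtain x y where xy: "d x y = 2" using pair_at_distance assms by blast
  have "2 \<le> card {z. G x z \<and> d z y + 1 = 2}" using card_closer[OF xy] assms by simp
  then obtain S where S: "S \<subseteq> {z. G x z \<and> d z y + 1 = 2}" "card S = 2"
    by (rule obtain_subset_with_card_n)
  then obtain z w where zw: "z \<noteq> w" "G x z" "G z y" "G x w" "G w y"
    by (auto simp: card_2_iff dist_eq_Suc_0_iff)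
  have yw: "G y w" "G w x" using zw adj_sym by blast+
  have ne: "x \<noteq> y" "x \<noteq> z" "z \<noteq> y" "x \<noteq> w" "w \<noteq> y"
    using xy zw adj_irrefl[of x] adj_irrefl[of y] by auto
  have "G ([x, z, y, w] ! i) ([x, z, y, w] ! (Suc i mod 4))" if i: "i < 4" for i
  proof -
    consider "i = 0" | "i = 1" | "i = 2" | "i = 3" using i by linarith
    then show ?thesis by cases (use zw yw in \<open>simp_all add: numeral_2_eq_2[symmetric]\<close>)
  qed
  then have "is_cycle G [x, z, y, w]"
    using zw(1) ne by (auto simp: is_cycle_def)
  then have "girth G \<le> enat (length [x, z, y, w])"
    unfolding girth_def by (intro INF_lower) simp
  then show "girth G \<le> 4" by (simp add: numeral_eq_enat eval_nat_numeral)
  have "4 \<le> length vs" if vs: "is_cycle G vs" for vs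
  proof (rule ccontr)
    assume "\<not> 4 \<le> length vs"
    then have l: "length vs = 3" using vs by (simp add: is_cycle_def)
    then have "G (vs ! i) (vs ! (Suc i mod 3))" if "i < 3" for i
      using vs that by (simp add: is_cycle_def)
    from this[of 0] this[of 1] this[of 2]
    have "G (vs ! 0) (vs ! 1)" "G (vs ! 1) (vs ! 2)" "G (vs ! 2) (vs ! 0)"
      by (simp_all add: numeral_2_eq_2)
    then have "d (vs ! 0) (vs ! 1) = 1" "d (vs ! 2) (vs ! 0) = 1" "G (vs ! 1) (vs ! 2)"
      unfolding dist_eq_1_iff by blast+
    then show False
      using dist_parity[of "vs ! 1" "vs ! 2" "vs ! 0"] dist_commute[of "vs ! 2" "vs ! 0"] by linarith
  qed
  then show "4 \<le> girth G"
    unfolding girth_def by (intro INF_greatest) (simp add: numeral_eq_enat)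
qed

end

theorem theorem5p5:
  fixes G :: "('v::finite) graph" and D k :: nat
  assumes "distance_regular G"
    and "bipartite_graph G"
    and "Q_polynomial G"
    and "diam G = D"
    and "regular_graph G k"
    and "k \<ge> 3"
    and "D \<ge> 6"
  shows "c_number G 2 \<ge> 2 \<and> girth G = 4"
proof -
  obtain p where p: "\<And>x y i j. card (gsphere G i x \<inter> gsphere G j y) = p (gdist G x y) i j"
    using assms(1) unfolding distance_regular_def by blast
  interpret bipartite_drg G p D k
    using assms p by unfold_locales (auto simp: distance_regular_def)
  obtain E :: "nat \<Rightarrow> real ^ 'v ^ 'v" and q where Eq:
    "bij_betw E {0..D} {e. primitive_idempotent_in (bose_mesner G) e}"
    "E 0 = (1 / real CARD('v)) *\<^sub>R (\<chi> x y. 1)" "krein_parameters D E q"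
    "\<And>i j. i \<le> D \<Longrightarrow> j \<le> D \<Longrightarrow> i \<noteq> j \<Longrightarrow> q 1 i j \<noteq> 0 \<longleftrightarrow> \<bar>int i - int j\<bar> = 1"
    using assms(3) unfolding Q_polynomial_def assms(4) by blast
  interpret bipartite_qdrg G p D k E q
    using Eq assms(7) by unfold_locales auto
  have "2 \<le> c 2" using c_2_ge_2 assms by simp
  then show ?thesis using c_number_eq girth_eq_4 assms by simp
qed

end
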